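(* Each Lorentz surface of general type with parallel normalized mean curvature vector field in $\mathbb{E}^4_2$ locally admits canonical parameters; that is, every point of the surface has a neighbourhood on which there exist parameters $(u,v)$ with $$E=\frac1{|\mu|},\qquad F=0,\qquad G=-\frac1{|\mu|}.$$
   Context: $\mathbb{E}^4_2$ is $\mathbb{R}^4$ with the standard orientation and the metric $\langle\cdot,\cdot\rangle=dx_1^2+dx_2^2-dx_3^2-dx_4^2$; $\nabla'$ is its Levi-Civita connection. A Lorentz surface $M^2_1:z=z(u,v)$, $(u,v)$ in a domain of $\mathbb{R}^2$, is a smooth immersed surface whose induced metric has signature $(1,1)$. $\sigma$ is its second fundamental form (normal part of $\nabla'_XY$), $D$ its normal connection (normal part of $\nabla'_X\xi$ for normal $\xi$), and $H=\frac12\operatorname{tr}\sigma=\frac12(\sigma(x,x)-\sigma(y,y))$ for tangent orthonormal $x,y$ with $\langle x,x\rangle=1$, $\langle y,y\rangle=-1$. Write $E=\langle z_u,z_u\rangle>0$, $F=\langle z_u,z_v\rangle$, $G=\langle z_v,z_v\rangle<0$ (parameters are always taken with these signs), $W=\sqrt{|EG-F^2|}$. For a normal frame $n_1,n_2$ with $\langle n_1,n_1\rangle=1$, $\langle n_2,n_2\rangle=-1$, $\langle n_1,n_2\rangle=0$ put $c_{11}^k=\langle z_{uu},n_k\rangle$, $c_{12}^k=\langle z_{uv},n_k\rangle$, $c_{22}^k=\langle z_{vv},n_k\rangle$, $\Delta_1=c_{11}^1c_{12}^2-c_{12}^1c_{11}^2$, $\Delta_2=c_{11}^1c_{22}^2-c_{22}^1c_{11}^2$,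 $\Delta_3=c_{12}^1c_{22}^2-c_{22}^1c_{12}^2$, $L=2\Delta_1/W$, $M=\Delta_2/W$, $N=2\Delta_3/W$, $k=\frac{LN-M^2}{EG-F^2}$, $\varkappa=\frac{EN+GL-2FM}{2(EG-F^2)}$. A Lorentz surface of general type is one that is free of flat points, i.e. $(L,M,N)\ne(0,0,0)$ everywhere, satisfies $\varkappa^2-k>0$ everywhere, and whose mean curvature vector $H$ is at each point non-zero and either spacelike ($\langle H,H\rangle>0$) or timelike ($\langle H,H\rangle<0$). Set $\varepsilon=\operatorname{sign}\langle H,H\rangle$. Parameters are principal if $F=0$ and $M=0$; since $\varkappa^2-k>0$ such parameters exist locally. In principal parameters put $x=z_u/\sqrt{E}$, $y=z_v/\sqrt{-G}$, $b=\varepsilon H/\sqrt{\varepsilon\langle H,H\rangle}$ (so $\langle b,b\rangle=\varepsilon$), and let $l$ be the normal field with $\langle l,l\rangle=-\varepsilon$, $\langle b,l\rangle=0$, such that $(x,y,b,l)$ is positively oriented if $\varepsilon=1$ and $(x,y,l,b)$ is positively oriented if $\varepsilon=-1$. The geometric function $\mu$ is $\mu=\langle\sigma(x,y),l\rangle$; it is nowhere zero and $|\mu|$ does not depend on the choice of principal parameters. The surface has parallel normalized mean curvature vector field if $H$ is non-zero and there is a unit normal field $b$ in the direction of $H$ with $Db=0$. For such a surface of general type, parameters $(u,v)$ are called canonical if $E=\frac1{|\mu|}$, $F=0$, $G=-\frac1{|\mu|}$. *)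

theory Defs
  imports "HOL-Analysis.Analysis"
begin

section \<open>Smooth maps and changes of parameters in the plane\<close>

definition pd_u :: "(real \<times> real \<Rightarrow> 'a::real_normed_vector) \<Rightarrow> real \<times> real \<Rightarrow> 'a" where
  "pd_u f p = frechet_derivative f (at p) (1, 0)"

definition pd_v :: "(real \<times> real \<Rightarrow> 'a::real_normed_vector) \<Rightarrow> real \<times> real \<Rightarrow> 'a" where
  "pd_v f p = frechet_derivative f (at p) (0, 1)"

text \<open>The next two notions are only used for open sets \<open>U\<close>, where \<open>smooth_on_plane\<close> is the usual
  notion of a map of class \<open>C\<close>-infinity.\<close>

fun Ck_on :: "nat \<Rightarrow> (real \<times> real \<Rightarrow> 'a::real_normed_vector) \<Rightarrow> (real \<times> real) set \<Rightarrow> bool" where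
  "Ck_on 0 f U \<longleftrightarrow> continuous_on U f"
| "Ck_on (Suc n) f U \<longleftrightarrow>
     (\<forall>p\<in>U. f differentiable (at p)) \<and> Ck_on n (pd_u f) U \<and> Ck_on n (pd_v f) U"

definition smooth_on_plane :: "(real \<times> real \<Rightarrow> 'a::real_normed_vector) \<Rightarrow> (real \<times> real) set \<Rightarrow> bool" where
  "smooth_on_plane f U \<longleftrightarrow> (\<forall>n. Ck_on n f U)"

definition plane_domain :: "(real \<times> real) set \<Rightarrow> bool" where
  "plane_domain U \<longleftrightarrow> open U \<and> connected U"

definition plane_diffeo :: "(real \<times> real \<Rightarrow> real \<times> real) \<Rightarrow> (real \<times> real) set \<Rightarrow> (real \<times> real) set \<Rightarrow> bool" where
  "plane_diffeo \<phi> V U \<longleftrightarrow>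
     bij_betw \<phi> V U \<and> smooth_on_plane \<phi> V \<and> smooth_on_plane (inv_into V \<phi>) U"


section \<open>The pseudo-Euclidean space with neutral metric\<close>

definition nmetric :: "real^4 \<Rightarrow> real^4 \<Rightarrow> real" where
  "nmetric x y = x$1 * y$1 + x$2 * y$2 - x$3 * y$3 - x$4 * y$4"

definition positively_oriented :: "real^4 \<Rightarrow> real^4 \<Rightarrow> real^4 \<Rightarrow> real^4 \<Rightarrow> bool" where
  "positively_oriented a b c d \<longleftrightarrow> det (vector [a, b, c, d] :: real^4^4) > 0"


section \<open>First fundamental form and Lorentz surfaces\<close>

definition coeff_E :: "(real \<times> real \<Rightarrow> real^4) \<Rightarrow> real \<times> real \<Rightarrow> real" where
  "coeff_E z p = nmetric (pd_u z p) (pd_u z p)"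

definition coeff_F :: "(real \<times> real \<Rightarrow> real^4) \<Rightarrow> real \<times> real \<Rightarrow> real" where
  "coeff_F z p = nmetric (pd_u z p) (pd_v z p)"

definition coeff_G :: "(real \<times> real \<Rightarrow> real^4) \<Rightarrow> real \<times> real \<Rightarrow> real" where
  "coeff_G z p = nmetric (pd_v z p) (pd_v z p)"

definition coeff_W :: "(real \<times> real \<Rightarrow> real^4) \<Rightarrow> real \<times> real \<Rightarrow> real" where
  "coeff_W z p = sqrt \<bar>coeff_E z p * coeff_G z p - (coeff_F z p)\<^sup>2\<bar>"

text \<open>The sign convention for the parameters, \<open>E > 0\<close> and \<open>G < 0\<close>.  It gives \<open>E * G - F\<^sup>2 < 0\<close>,
  so that \<open>z\<close> is automatically an immersion and its induced metric has signature \<open>(1,1)\<close>.\<close>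

definition admissible_at :: "(real \<times> real \<Rightarrow> real^4) \<Rightarrow> real \<times> real \<Rightarrow> bool" where
  "admissible_at z p \<longleftrightarrow> coeff_E z p > 0 \<and> coeff_G z p < 0"

definition lorentz_surface :: "(real \<times> real) set \<Rightarrow> (real \<times> real \<Rightarrow> real^4) \<Rightarrow> bool" where
  "lorentz_surface U z \<longleftrightarrow>
     plane_domain U \<and> smooth_on_plane z U \<and> (\<forall>p\<in>U. admissible_at z p)"


section \<open>Second fundamental form, normal connection, mean curvature\<close>

definition normal_at :: "(real \<times> real \<Rightarrow> real^4) \<Rightarrow> real \<times> real \<Rightarrow> real^4 \<Rightarrow> bool" where
  "normal_at z p n \<longleftrightarrow> nmetric n (pd_u z p) = 0 \<and> nmetric n (pd_v z p) = 0"

definition normal_part :: "(real \<times> real \<Rightarrow> real^4) \<Rightarrow> real \<times> real \<Rightarrow> real^4 \<Rightarrow> real^4" where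
  "normal_part z p w = (THE n. normal_at z p n \<and> w - n \<in> span {pd_u z p, pd_v z p})"

text \<open>A tangent vector at \<open>z p\<close> is represented by its components \<open>\<xi>\<close> with respect to \<open>z\<^sub>u, z\<^sub>v\<close>.\<close>

definition tangent :: "(real \<times> real \<Rightarrow> real^4) \<Rightarrow> real \<times> real \<Rightarrow> real \<times> real \<Rightarrow> real^4" where
  "tangent z p \<xi> = frechet_derivative z (at p) \<xi>"

text \<open>The Levi-Civita connection of the ambient space is the flat one, i.e. directional
  differentiation.  The second fundamental form is the normal part of the derivative of \<open>Y\<close> along
  \<open>X\<close>; being tensorial it may be computed by extending \<open>Y\<close> to the tangent field with the
  same constant components \<open>\<eta>\<close>.\<close>

definition sff :: "(real \<times> real \<Rightarrow> real^4) \<Rightarrow> real \<times> real \<Rightarrow> real \<times> real \<Rightarrow> real \<times> real \<Rightarrow> real^4" where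
  "sff z p \<xi> \<eta> = normal_part z p (frechet_derivative (\<lambda>q. tangent z q \<eta>) (at p) \<xi>)"

definition normal_connection ::
    "(real \<times> real \<Rightarrow> real^4) \<Rightarrow> (real \<times> real \<Rightarrow> real^4) \<Rightarrow> real \<times> real \<Rightarrow> real \<times> real \<Rightarrow> real^4" where
  "normal_connection z n p \<xi> = normal_part z p (frechet_derivative n (at p) \<xi>)"

definition orthonormal_tangents :: "(real \<times> real \<Rightarrow> real^4) \<Rightarrow> real \<times> real \<Rightarrow> real \<times> real \<Rightarrow> real \<times> real \<Rightarrow> bool" where
  "orthonormal_tangents z p \<xi> \<eta> \<longleftrightarrow>
     nmetric (tangent z p \<xi>) (tangent z p \<xi>) = 1 \<and>
     nmetric (tangent z p \<eta>) (tangent z p \<eta>) = - 1 \<and>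
     nmetric (tangent z p \<xi>) (tangent z p \<eta>) = 0"

definition mean_curvature :: "(real \<times> real \<Rightarrow> real^4) \<Rightarrow> real \<times> real \<Rightarrow> real^4" where
  "mean_curvature z p =
     (THE h. \<forall>\<xi> \<eta>. orthonormal_tangents z p \<xi> \<eta> \<longrightarrow>
        h = (1/2) *\<^sub>R (sff z p \<xi> \<xi> - sff z p \<eta> \<eta>))"


section \<open>The functions L, M, N and the invariants built from them\<close>

definition normal_frame :: "(real \<times> real \<Rightarrow> real^4) \<Rightarrow> real \<times> real \<Rightarrow> real^4 \<Rightarrow> real^4 \<Rightarrow> bool" where
  "normal_frame z p n1 n2 \<longleftrightarrow> normal_at z p n1 \<and> normal_at z p n2 \<and>
     nmetric n1 n1 = 1 \<and> nmetric n2 n2 = - 1 \<and> nmetric n1 n2 = 0"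

definition c11 :: "(real \<times> real \<Rightarrow> real^4) \<Rightarrow> real \<times> real \<Rightarrow> real^4 \<Rightarrow> real" where
  "c11 z p n = nmetric (pd_u (pd_u z) p) n"

definition c12 :: "(real \<times> real \<Rightarrow> real^4) \<Rightarrow> real \<times> real \<Rightarrow> real^4 \<Rightarrow> real" where
  "c12 z p n = nmetric (pd_v (pd_u z) p) n"

definition c22 :: "(real \<times> real \<Rightarrow> real^4) \<Rightarrow> real \<times> real \<Rightarrow> real^4 \<Rightarrow> real" where
  "c22 z p n = nmetric (pd_v (pd_v z) p) n"

definition Delta1 :: "(real \<times> real \<Rightarrow> real^4) \<Rightarrow> real \<times> real \<Rightarrow> real^4 \<Rightarrow> real^4 \<Rightarrow> real" where
  "Delta1 z p n1 n2 = c11 z p n1 * c12 z p n2 - c12 z p n1 * c11 z p n2"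

definition Delta2 :: "(real \<times> real \<Rightarrow> real^4) \<Rightarrow> real \<times> real \<Rightarrow> real^4 \<Rightarrow> real^4 \<Rightarrow> real" where
  "Delta2 z p n1 n2 = c11 z p n1 * c22 z p n2 - c22 z p n1 * c11 z p n2"

definition Delta3 :: "(real \<times> real \<Rightarrow> real^4) \<Rightarrow> real \<times> real \<Rightarrow> real^4 \<Rightarrow> real^4 \<Rightarrow> real" where
  "Delta3 z p n1 n2 = c12 z p n1 * c22 z p n2 - c22 z p n1 * c12 z p n2"

definition coeff_L :: "(real \<times> real \<Rightarrow> real^4) \<Rightarrow> real \<times> real \<Rightarrow> real^4 \<Rightarrow> real^4 \<Rightarrow> real" where
  "coeff_L z p n1 n2 = 2 * Delta1 z p n1 n2 / coeff_W z p"

definition coeff_M :: "(real \<times> real \<Rightarrow> real^4) \<Rightarrow> real \<times> real \<Rightarrow> real^4 \<Rightarrow> real^4 \<Rightarrow> real" where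
  "coeff_M z p n1 n2 = Delta2 z p n1 n2 / coeff_W z p"

definition coeff_N :: "(real \<times> real \<Rightarrow> real^4) \<Rightarrow> real \<times> real \<Rightarrow> real^4 \<Rightarrow> real^4 \<Rightarrow> real" where
  "coeff_N z p n1 n2 = 2 * Delta3 z p n1 n2 / coeff_W z p"

definition inv_k :: "(real \<times> real \<Rightarrow> real^4) \<Rightarrow> real \<times> real \<Rightarrow> real^4 \<Rightarrow> real^4 \<Rightarrow> real" where
  "inv_k z p n1 n2 =
     (coeff_L z p n1 n2 * coeff_N z p n1 n2 - (coeff_M z p n1 n2)\<^sup>2) /
     (coeff_E z p * coeff_G z p - (coeff_F z p)\<^sup>2)"

definition inv_kappa :: "(real \<times> real \<Rightarrow> real^4) \<Rightarrow> real \<times> real \<Rightarrow> real^4 \<Rightarrow> real^4 \<Rightarrow> real" where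
  "inv_kappa z p n1 n2 =
     (coeff_E z p * coeff_N z p n1 n2 + coeff_G z p * coeff_L z p n1 n2
        - 2 * coeff_F z p * coeff_M z p n1 n2) /
     (2 * (coeff_E z p * coeff_G z p - (coeff_F z p)\<^sup>2))"

text \<open>Another choice of the normal frame only changes \<open>L, M, N\<close> by a common sign, so the conditions
  below do not depend on it.  A normal frame exists at every point of a Lorentz surface, so
  quantifying over all frames is never vacuous there.\<close>

definition general_type :: "(real \<times> real) set \<Rightarrow> (real \<times> real \<Rightarrow> real^4) \<Rightarrow> bool" where
  "general_type U z \<longleftrightarrow>
     (\<forall>p\<in>U.
        (\<forall>n1 n2. normal_frame z p n1 n2 \<longrightarrow>
           (coeff_L z p n1 n2, coeff_M z p n1 n2, coeff_N z p n1 n2) \<noteq> (0, 0, 0) \<and>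
           (inv_kappa z p n1 n2)\<^sup>2 - inv_k z p n1 n2 > 0) \<and>
        mean_curvature z p \<noteq> 0 \<and>
        (nmetric (mean_curvature z p) (mean_curvature z p) > 0 \<or>
         nmetric (mean_curvature z p) (mean_curvature z p) < 0))"

definition principal_at :: "(real \<times> real \<Rightarrow> real^4) \<Rightarrow> real \<times> real \<Rightarrow> bool" where
  "principal_at z p \<longleftrightarrow> admissible_at z p \<and> coeff_F z p = 0 \<and>
     (\<forall>n1 n2. normal_frame z p n1 n2 \<longrightarrow> coeff_M z p n1 n2 = 0)"


section \<open>The geometric frame and the function mu\<close>

definition eps :: "(real \<times> real \<Rightarrow> real^4) \<Rightarrow> real \<times> real \<Rightarrow> real" where
  "eps z p = sgn (nmetric (mean_curvature z p) (mean_curvature z p))"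

text \<open>Components of \<open>x = z\<^sub>u / sqrt E\<close> and \<open>y = z\<^sub>v / sqrt (-G)\<close> with respect to \<open>z\<^sub>u, z\<^sub>v\<close>.\<close>

definition comp_x :: "(real \<times> real \<Rightarrow> real^4) \<Rightarrow> real \<times> real \<Rightarrow> real \<times> real" where
  "comp_x z p = (1 / sqrt (coeff_E z p), 0)"

definition comp_y :: "(real \<times> real \<Rightarrow> real^4) \<Rightarrow> real \<times> real \<Rightarrow> real \<times> real" where
  "comp_y z p = (0, 1 / sqrt (- coeff_G z p))"

definition frame_b :: "(real \<times> real \<Rightarrow> real^4) \<Rightarrow> real \<times> real \<Rightarrow> real^4" where
  "frame_b z p =
     (eps z p / sqrt (eps z p * nmetric (mean_curvature z p) (mean_curvature z p)))
       *\<^sub>R mean_curvature z p"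

definition frame_l :: "(real \<times> real \<Rightarrow> real^4) \<Rightarrow> real \<times> real \<Rightarrow> real^4" where
  "frame_l z p =
     (THE l. normal_at z p l \<and> nmetric l l = - eps z p \<and> nmetric (frame_b z p) l = 0 \<and>
        (if eps z p = 1
         then positively_oriented (tangent z p (comp_x z p)) (tangent z p (comp_y z p)) (frame_b z p) l
         else positively_oriented (tangent z p (comp_x z p)) (tangent z p (comp_y z p)) l (frame_b z p)))"

text \<open>This is the geometric function \<open>\<mu>\<close> only where the parameters of \<open>z\<close> are principal.\<close>

definition mu :: "(real \<times> real \<Rightarrow> real^4) \<Rightarrow> real \<times> real \<Rightarrow> real" where
  "mu z p = nmetric (sff z p (comp_x z p) (comp_y z p)) (frame_l z p)"


section \<open>Parallel normalized mean curvature vector field and canonical parameters\<close>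

definition parallel_normalized_mean_curvature :: "(real \<times> real) set \<Rightarrow> (real \<times> real \<Rightarrow> real^4) \<Rightarrow> bool" where
  "parallel_normalized_mean_curvature U z \<longleftrightarrow>
     (\<forall>p\<in>U. mean_curvature z p \<noteq> 0) \<and>
     (\<exists>b. smooth_on_plane b U \<and>
        (\<forall>p\<in>U. normal_at z p (b p) \<and> \<bar>nmetric (b p) (b p)\<bar> = 1 \<and>
           (\<exists>c. mean_curvature z p = c *\<^sub>R b p) \<and>
           (\<forall>\<xi>. normal_connection z b p \<xi> = 0)))"

text \<open>The function \<open>\<mu>\<close> is formed with respect to principal parameters, so canonical parameters
  are in particular principal.\<close>

definition canonical_parameters :: "(real \<times> real) set \<Rightarrow> (real \<times> real \<Rightarrow> real^4) \<Rightarrow> bool" where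
  "canonical_parameters V w \<longleftrightarrow>
     (\<forall>q\<in>V. principal_at w q \<and>
        coeff_E w q = 1 / \<bar>mu w q\<bar> \<and> coeff_F w q = 0 \<and> coeff_G w q = - 1 / \<bar>mu w q\<bar>)"

end

theory Submission
  imports Defs
begin

text \<open>
  Let \<open>b\<close> be the parallel unit normal field in the direction of the mean curvature vector and \<open>l\<close> the unit
  normal field orthogonal to it, which is then parallel as well.  The second fundamental form in the direction of
  \<open>l\<close> has trace zero, because the mean curvature vector is a multiple of \<open>b\<close>.  A traceless form has no mixed
  term with respect to the two null directions of the Lorentz metric.  Moreover \<open>\<kappa>\<^sup>2 - k\<close> is
  a positive multiple of its discriminant times the squared trace of the other form
  (\<open>discriminant_factors\<close>), so the condition \<open>\<kappa>\<^sup>2 - k > 0\<close> forces opposite signs on the two null directions.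
  Up to the sign of \<open>l\<close> the form is therefore \<open>(p\<^sup>2 - q\<^sup>2) / 2\<close> with null one-forms \<open>p, q\<close>, and the metric
  is \<open>p q / m\<close> with a positive function \<open>m\<close>.

  The Codazzi equations for the parallel normal \<open>l\<close> say precisely that \<open>p\<close> and \<open>q\<close> are closed
  (\<open>null_coframe_closed\<close>).  This is the analogue of the fact that the Hopf differential is
  holomorphic: each null component depends on one null coordinate only.  Hence \<open>(p + q) / 2\<close> and
  \<open>(p - q) / 2\<close> are closed, and by the Poincare lemma (\<open>closed_form_has_potential\<close>) they are locally the
  differentials of functions \<open>u, v\<close>.  The inverse function theorem (\<open>local_diffeo\<close>) makes these functions
  parameters.  In them the metric is \<open>(du\<^sup>2 - dv\<^sup>2) / m\<close> and the form in the direction of \<open>l\<close> is \<open>2 du dv\<close>.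
  So the parameters are principal and \<open>m = \<bar>\<mu>\<bar>\<close> (\<open>canonical_at\<close>), which means that they are canonical.
\<close>

section \<open>Partial derivatives and smooth functions in the plane\<close>

lemma pd_eqI:
  assumes "(f has_derivative D) (at p)"
  shows "pd_u f p = D (1, 0)" "pd_v f p = D (0, 1)"
  using frechet_derivative_at[OF assms] by (simp_all add: pd_u_def pd_v_def)

lemma frechet_derivative_plane:
  assumes "f differentiable (at p)"
  shows "frechet_derivative f (at p) h = fst h *\<^sub>R pd_u f p + snd h *\<^sub>R pd_v f p"
proof -
  have lin: "linear (frechet_derivative f (at p))"
    using assms by (simp add: linear_frechet_derivative)
  have "h = fst h *\<^sub>R (1, 0) + snd h *\<^sub>R (0, 1)" by (cases h) simp
  then have "frechet_derivative f (at p) h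
      = frechet_derivative f (at p) (fst h *\<^sub>R (1, 0) + snd h *\<^sub>R (0, 1))" by simp
  also have "\<dots> = fst h *\<^sub>R pd_u f p + snd h *\<^sub>R pd_v f p"
    unfolding linear_add[OF lin] linear_scale[OF lin] pd_u_def pd_v_def ..
  finally show ?thesis .
qed

lemma has_derivative_plane:
  assumes "f differentiable (at p)"
  shows "(f has_derivative (\<lambda>h. fst h *\<^sub>R pd_u f p + snd h *\<^sub>R pd_v f p)) (at p)"
proof -
  have "frechet_derivative f (at p) = (\<lambda>h. fst h *\<^sub>R pd_u f p + snd h *\<^sub>R pd_v f p)"
    using frechet_derivative_plane[OF assms] by auto
  then show ?thesis
    using frechet_derivative_works assms by metis
qed

lemma differentiable_plane_cong:
  assumes "open U" "p \<in> U" "\<And>q. q \<in> U \<Longrightarrow> f q = g q" "f differentiable (at p)"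
  shows "g differentiable (at p)" "pd_u g p = pd_u f p" "pd_v g p = pd_v f p"
proof -
  have d: "(g has_derivative (\<lambda>h. fst h *\<^sub>R pd_u f p + snd h *\<^sub>R pd_v f p)) (at p)"
    by (rule has_derivative_transform_within_open[OF has_derivative_plane[OF assms(4)] assms(1,2)])
      (rule assms(3))
  show "g differentiable (at p)" by (rule differentiableI[OF d])
  show "pd_u g p = pd_u f p" "pd_v g p = pd_v f p"
    using pd_eqI[OF d] by simp_all
qed

lemma Ck_on_cong:
  assumes "open U" "\<And>q. q \<in> U \<Longrightarrow> f q = g q" "Ck_on n f U"
  shows "Ck_on n g U"
  using assms(2,3)
proof (induction n arbitrary: f g)
  case 0
  then show ?case unfolding Ck_on.simps by (metis continuous_on_cong)
next
  case (Suc n)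
  have d: "g differentiable (at p)" "pd_u f p = pd_u g p" "pd_v f p = pd_v g p"
    if "p \<in> U" for p
    using differentiable_plane_cong[OF assms(1) that Suc.prems(1)] Suc.prems(2) that by auto
  have "Ck_on n (pd_u f) U" "Ck_on n (pd_v f) U" using Suc.prems(2) by simp_all
  note C = this
  have "Ck_on n (pd_u g) U" by (rule Suc.IH[OF _ C(1)]) (rule d)
  moreover have "Ck_on n (pd_v g) U" by (rule Suc.IH[OF _ C(2)]) (rule d)
  ultimately show ?case using d(1) by simp
qed

lemma Ck_on_Suc_imp: "Ck_on (Suc n) f U \<Longrightarrow> Ck_on n f U"
proof (induction n arbitrary: f)
  case 0
  then show ?case
    by (simp add: differentiable_imp_continuous_within continuous_at_imp_continuous_on)
next
  case (Suc n)
  have "Ck_on n (pd_u f) U" "Ck_on n (pd_v f) U"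
    using Suc.IH[of "pd_u f"] Suc.IH[of "pd_v f"] Suc.prems unfolding Ck_on.simps(2)[of "Suc n"]
    by blast+
  then show ?case using Suc.prems unfolding Ck_on.simps(2) by blast
qed

lemma Ck_on_subset: "Ck_on n f U \<Longrightarrow> V \<subseteq> U \<Longrightarrow> Ck_on n f V"
proof (induction n arbitrary: f)
  case 0
  then show ?case unfolding Ck_on.simps by (rule continuous_on_subset)
next
  case (Suc n)
  then show ?case unfolding Ck_on.simps by blast
qed

text \<open>Regularity is raised one step at a time: it suffices to exhibit a total derivative whose two
  coefficients already have the lower regularity.\<close>

lemma Ck_on_SucI:
  assumes U: "open U"
    and d: "\<And>p. p \<in> U \<Longrightarrow> (f has_derivative (\<lambda>h. fst h *\<^sub>R fu p + snd h *\<^sub>R fv p)) (at p)"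
    and C: "Ck_on n fu U" "Ck_on n fv U"
  shows "Ck_on (Suc n) f U"
proof -
  have eq: "pd_u f p = fu p" "pd_v f p = fv p" if "p \<in> U" for p
    using pd_eqI[OF d[OF that]] by auto
  have "f differentiable (at p)" if "p \<in> U" for p
    using d[OF that] by (rule differentiableI)
  moreover have "Ck_on n (pd_u f) U" "Ck_on n (pd_v f) U"
    by (rule Ck_on_cong[OF U _ C(1)], simp add: eq) (rule Ck_on_cong[OF U _ C(2)], simp add: eq)
  ultimately show ?thesis by simp
qed

lemma Ck_on_const: "open U \<Longrightarrow> Ck_on n (\<lambda>_. c) U"
proof (induction n arbitrary: c)
  case (Suc n)
  have "((\<lambda>_. c) has_derivative (\<lambda>h. fst h *\<^sub>R 0 + snd h *\<^sub>R 0)) (at p)" for p :: "real \<times> real"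
    by simp
  then show ?case using Ck_on_SucI[of U "\<lambda>_. c" "\<lambda>_. 0" "\<lambda>_. 0" n] Suc by auto
qed simp

lemma Ck_on_bounded_linear:
  assumes U: "open U" and L: "bounded_linear L"
  shows "Ck_on n f U \<Longrightarrow> Ck_on n (\<lambda>p. L (f p)) U"
proof (induction n arbitrary: f)
  case 0
  then show ?case
    by (simp add: linear_continuous_on[OF L] continuous_on_compose2[of UNIV L U f])
next
  case (Suc n)
  interpret bounded_linear L by (rule L)
  have d: "((\<lambda>p. L (f p)) has_derivative
      (\<lambda>h. fst h *\<^sub>R L (pd_u f p) + snd h *\<^sub>R L (pd_v f p))) (at p)" if "p \<in> U" for p
    by (rule has_derivative_eq_rhs[OF has_derivative[OF has_derivative_plane[of f p]]])
      (use Suc.prems that in \<open>simp_all add: add scale\<close>)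
  have D: "Ck_on n (pd_u f) U" "Ck_on n (pd_v f) U"
    using Suc.prems by auto
  show ?case
    by (rule Ck_on_SucI[OF U d Suc.IH[OF D(1)] Suc.IH[OF D(2)]])
qed

lemma Ck_on_add:
  assumes U: "open U"
  shows "Ck_on n f U \<Longrightarrow> Ck_on n g U \<Longrightarrow> Ck_on n (\<lambda>p. f p + g p) U"
proof (induction n arbitrary: f g)
  case 0
  then show ?case by (simp add: continuous_on_add)
next
  case (Suc n)
  have d: "((\<lambda>p. f p + g p) has_derivative
      (\<lambda>h. fst h *\<^sub>R (pd_u f p + pd_u g p) + snd h *\<^sub>R (pd_v f p + pd_v g p))) (at p)"
    if "p \<in> U" for p
    by (rule has_derivative_eq_rhs[OF has_derivative_add[OF has_derivative_plane[of f p]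
            has_derivative_plane[of g p]]])
      (use Suc.prems that in \<open>simp_all add: fun_eq_iff scaleR_add_right\<close>)
  have D: "Ck_on n (pd_u f) U" "Ck_on n (pd_v f) U" "Ck_on n (pd_u g) U" "Ck_on n (pd_v g) U"
    using Suc.prems by auto
  show ?case
    by (rule Ck_on_SucI[OF U d Suc.IH[OF D(1,3)] Suc.IH[OF D(2,4)]])
qed

lemma has_derivative_plane_bilinear:
  assumes "bounded_bilinear B" "f differentiable (at p)" "g differentiable (at p)"
  shows "((\<lambda>p. B (f p) (g p)) has_derivative
      (\<lambda>h. fst h *\<^sub>R (B (f p) (pd_u g p) + B (pd_u f p) (g p))
         + snd h *\<^sub>R (B (f p) (pd_v g p) + B (pd_v f p) (g p)))) (at p)"
proof -
  interpret B: bounded_bilinear B by (rule assms)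
  have "B (f p) (fst h *\<^sub>R pd_u g p + snd h *\<^sub>R pd_v g p)
      + B (fst h *\<^sub>R pd_u f p + snd h *\<^sub>R pd_v f p) (g p)
      = fst h *\<^sub>R (B (f p) (pd_u g p) + B (pd_u f p) (g p))
      + snd h *\<^sub>R (B (f p) (pd_v g p) + B (pd_v f p) (g p))" for h
    unfolding B.add_left B.add_right B.scaleR_left B.scaleR_right scaleR_add_right by simp
  then show ?thesis
    using B.FDERIV[OF has_derivative_plane[OF assms(2)] has_derivative_plane[OF assms(3)]] by simp
qed

lemma pd_bilinear:
  assumes "bounded_bilinear B" "f differentiable (at p)" "g differentiable (at p)"
  shows "pd_u (\<lambda>p. B (f p) (g p)) p = B (f p) (pd_u g p) + B (pd_u f p) (g p)"
    "pd_v (\<lambda>p. B (f p) (g p)) p = B (f p) (pd_v g p) + B (pd_v f p) (g p)"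
    "(\<lambda>p. B (f p) (g p)) differentiable (at p)"
proof -
  note d = has_derivative_plane_bilinear[OF assms]
  show "pd_u (\<lambda>p. B (f p) (g p)) p = B (f p) (pd_u g p) + B (pd_u f p) (g p)"
    using pd_eqI(1)[OF d] by simp
  show "pd_v (\<lambda>p. B (f p) (g p)) p = B (f p) (pd_v g p) + B (pd_v f p) (g p)"
    using pd_eqI(2)[OF d] by simp
  show "(\<lambda>p. B (f p) (g p)) differentiable (at p)"
    by (rule differentiableI[OF d])
qed

lemma Ck_on_bilinear:
  assumes U: "open U" and B: "bounded_bilinear B"
  shows "Ck_on n f U \<Longrightarrow> Ck_on n g U \<Longrightarrow> Ck_on n (\<lambda>p. B (f p) (g p)) U"
proof (induction n arbitrary: f g)
  case 0
  then show ?case unfolding Ck_on.simps by (rule bounded_bilinear.continuous_on[OF B])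
next
  case (Suc n)
  note mono = Ck_on_Suc_imp[OF Suc.prems(1)] Ck_on_Suc_imp[OF Suc.prems(2)]
  have D: "Ck_on n (pd_u f) U" "Ck_on n (pd_v f) U" "Ck_on n (pd_u g) U" "Ck_on n (pd_v g) U"
    using Suc.prems by auto
  show ?case
  proof (rule Ck_on_SucI[OF U])
    show "((\<lambda>p. B (f p) (g p)) has_derivative
      (\<lambda>h. fst h *\<^sub>R (B (f p) (pd_u g p) + B (pd_u f p) (g p))
         + snd h *\<^sub>R (B (f p) (pd_v g p) + B (pd_v f p) (g p)))) (at p)" if "p \<in> U" for p
      by (rule has_derivative_plane_bilinear[OF B]) (use Suc.prems that in simp_all)
  next
    show "Ck_on n (\<lambda>p. B (f p) (pd_u g p) + B (pd_u f p) (g p)) U"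
      by (rule Ck_on_add[OF U Suc.IH[OF mono(1) D(3)] Suc.IH[OF D(1) mono(2)]])
    show "Ck_on n (\<lambda>p. B (f p) (pd_v g p) + B (pd_v f p) (g p)) U"
      by (rule Ck_on_add[OF U Suc.IH[OF mono(1) D(4)] Suc.IH[OF D(2) mono(2)]])
  qed
qed

lemma has_derivative_plane_scalar:
  assumes "f differentiable (at p)" "(h has_real_derivative h' (f p)) (at (f p))"
  shows "((\<lambda>p. h (f p)) has_derivative
    (\<lambda>k. fst k *\<^sub>R (pd_u f p * h' (f p)) + snd k *\<^sub>R (pd_v f p * h' (f p)))) (at p)"
proof -
  have *: "(h has_derivative (*) (h' (f p))) (at (f p))"
    using assms(2) unfolding has_field_derivative_def .
  show ?thesis
    by (rule has_derivative_eq_rhs[OF has_derivative_compose[OF has_derivative_plane[OF assms(1)] *]])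
      (auto simp: algebra_simps)
qed

text \<open>The derivative of \<open>1 / f\<close> is a polynomial in the derivative of \<open>f\<close> and in \<open>1 / f\<close> itself, so the
  regularity of \<open>1 / f\<close> feeds its own induction step.  The same happens for the square root.\<close>

lemma Ck_on_inverse:
  fixes f :: "real \<times> real \<Rightarrow> real"
  assumes U: "open U" and nz: "\<And>p. p \<in> U \<Longrightarrow> f p \<noteq> 0"
  shows "Ck_on n f U \<Longrightarrow> Ck_on n (\<lambda>p. inverse (f p)) U"
proof (induction n)
  case 0
  then show ?case using nz by (simp add: continuous_on_inverse)
next
  case (Suc n)
  let ?h = "\<lambda>p. - (inverse (f p) * inverse (f p))"
  have I: "Ck_on n (\<lambda>p. inverse (f p)) U" by (rule Suc.IH[OF Ck_on_Suc_imp[OF Suc.prems]])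
  have C: "Ck_on n ?h U"
    by (rule Ck_on_bounded_linear[OF U bounded_linear_minus[OF bounded_linear_ident]
          Ck_on_bilinear[OF U bounded_bilinear_mult I I]])
  show ?case
  proof (rule Ck_on_SucI[OF U])
    show "((\<lambda>p. inverse (f p)) has_derivative
      (\<lambda>k. fst k *\<^sub>R (pd_u f p * ?h p) + snd k *\<^sub>R (pd_v f p * ?h p))) (at p)" if "p \<in> U" for p
    proof (rule has_derivative_plane_scalar[where h = inverse and h' = "\<lambda>x. - (inverse x * inverse x)"])
      show "(inverse has_real_derivative - (inverse (f p) * inverse (f p))) (at (f p))"
        using DERIV_inverse[of "f p"] nz[OF that] by (simp add: power2_eq_square)
    qed (use Suc.prems that in auto)
  qed (rule Ck_on_bilinear[OF U bounded_bilinear_mult _ C], use Suc.prems in simp)+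
qed

lemma Ck_on_sqrt:
  fixes f :: "real \<times> real \<Rightarrow> real"
  assumes U: "open U" and pos: "\<And>p. p \<in> U \<Longrightarrow> f p > 0"
  shows "Ck_on n f U \<Longrightarrow> Ck_on n (\<lambda>p. sqrt (f p)) U"
proof (induction n)
  case 0
  then have "continuous_on U f" by simp
  then show ?case unfolding Ck_on.simps by (rule continuous_on_real_sqrt)
next
  case (Suc n)
  let ?h = "\<lambda>p. inverse (sqrt (f p)) / 2"
  have I: "Ck_on n (\<lambda>p. sqrt (f p)) U" by (rule Suc.IH[OF Ck_on_Suc_imp[OF Suc.prems]])
  have "sqrt (f p) \<noteq> 0" if "p \<in> U" for p using pos[OF that] by simp
  then have C: "Ck_on n ?h U"
    by (rule Ck_on_bounded_linear[OF U bounded_linear_divide[of 2] Ck_on_inverse[OF U _ I]])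
  show ?case
  proof (rule Ck_on_SucI[OF U])
    show "((\<lambda>p. sqrt (f p)) has_derivative
      (\<lambda>k. fst k *\<^sub>R (pd_u f p * ?h p) + snd k *\<^sub>R (pd_v f p * ?h p))) (at p)" if "p \<in> U" for p
      by (rule has_derivative_plane_scalar[where f = f and p = p and h = sqrt and h' = "\<lambda>x. inverse (sqrt x) / 2",
            OF _ DERIV_real_sqrt[OF pos[OF that]]]) (use Suc.prems that in simp)
  qed (rule Ck_on_bilinear[OF U bounded_bilinear_mult _ C], use Suc.prems in simp)+
qed

lemma has_derivative_plane_comp:
  assumes "g differentiable (at (\<phi> p))" "\<phi> differentiable (at p)"
  shows "((\<lambda>p. g (\<phi> p)) has_derivative
      (\<lambda>h. fst h *\<^sub>R (fst (pd_u \<phi> p) *\<^sub>R pd_u g (\<phi> p) + snd (pd_u \<phi> p) *\<^sub>R pd_v g (\<phi> p))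
         + snd h *\<^sub>R (fst (pd_v \<phi> p) *\<^sub>R pd_u g (\<phi> p) + snd (pd_v \<phi> p) *\<^sub>R pd_v g (\<phi> p)))) (at p)"
proof -
  have "fst (fst h *\<^sub>R pd_u \<phi> p + snd h *\<^sub>R pd_v \<phi> p) *\<^sub>R pd_u g (\<phi> p)
      + snd (fst h *\<^sub>R pd_u \<phi> p + snd h *\<^sub>R pd_v \<phi> p) *\<^sub>R pd_v g (\<phi> p)
      = fst h *\<^sub>R (fst (pd_u \<phi> p) *\<^sub>R pd_u g (\<phi> p) + snd (pd_u \<phi> p) *\<^sub>R pd_v g (\<phi> p))
      + snd h *\<^sub>R (fst (pd_v \<phi> p) *\<^sub>R pd_u g (\<phi> p) + snd (pd_v \<phi> p) *\<^sub>R pd_v g (\<phi> p))"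
    for h :: "real \<times> real"
    by (simp add: scaleR_add_left scaleR_add_right)
  then show ?thesis
    using has_derivative_compose[OF has_derivative_plane[OF assms(2)] has_derivative_plane[OF assms(1)]]
    by simp
qed

lemma pd_comp:
  assumes "g differentiable (at (\<phi> p))" "\<phi> differentiable (at p)"
  shows "pd_u (\<lambda>p. g (\<phi> p)) p = fst (pd_u \<phi> p) *\<^sub>R pd_u g (\<phi> p) + snd (pd_u \<phi> p) *\<^sub>R pd_v g (\<phi> p)"
    "pd_v (\<lambda>p. g (\<phi> p)) p = fst (pd_v \<phi> p) *\<^sub>R pd_u g (\<phi> p) + snd (pd_v \<phi> p) *\<^sub>R pd_v g (\<phi> p)"
    "(\<lambda>p. g (\<phi> p)) differentiable (at p)"
proof -
  note d = has_derivative_plane_comp[OF assms]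
  show "pd_u (\<lambda>p. g (\<phi> p)) p = fst (pd_u \<phi> p) *\<^sub>R pd_u g (\<phi> p) + snd (pd_u \<phi> p) *\<^sub>R pd_v g (\<phi> p)"
    using pd_eqI(1)[OF d] by simp
  show "pd_v (\<lambda>p. g (\<phi> p)) p = fst (pd_v \<phi> p) *\<^sub>R pd_u g (\<phi> p) + snd (pd_v \<phi> p) *\<^sub>R pd_v g (\<phi> p)"
    using pd_eqI(2)[OF d] by simp
  show "(\<lambda>p. g (\<phi> p)) differentiable (at p)"
    by (rule differentiableI[OF d])
qed

lemma Ck_on_comp:
  assumes V: "open V" and sub: "\<phi> ` V \<subseteq> U"
  shows "Ck_on n g U \<Longrightarrow> Ck_on n \<phi> V \<Longrightarrow> Ck_on n (\<lambda>p. g (\<phi> p)) V"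
proof (induction n arbitrary: g)
  case 0
  then show ?case using continuous_on_compose2[of U g V \<phi>] sub by simp
next
  case (Suc n)
  note IH = Suc.IH[OF _ Ck_on_Suc_imp[OF Suc.prems(2)]]
  have C: "Ck_on n (\<lambda>p. fst (pd_u \<phi> p)) V" "Ck_on n (\<lambda>p. snd (pd_u \<phi> p)) V"
    "Ck_on n (\<lambda>p. fst (pd_v \<phi> p)) V" "Ck_on n (\<lambda>p. snd (pd_v \<phi> p)) V"
    using Suc.prems
    by (simp_all add: Ck_on_bounded_linear[OF V bounded_linear_fst]
        Ck_on_bounded_linear[OF V bounded_linear_snd])
  have D: "Ck_on n (\<lambda>p. pd_u g (\<phi> p)) V" "Ck_on n (\<lambda>p. pd_v g (\<phi> p)) V"
    using Suc.prems by (simp_all add: IH)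
  have "g differentiable (at (\<phi> p))" "\<phi> differentiable (at p)" if "p \<in> V" for p
    using Suc.prems sub that by auto
  note d = has_derivative_plane_comp[OF this]
  show ?case
    by (rule Ck_on_SucI[OF V d]; assumption?)
      (rule Ck_on_add[OF V Ck_on_bilinear[OF V bounded_bilinear_scaleR C(1) D(1)]
          Ck_on_bilinear[OF V bounded_bilinear_scaleR C(2) D(2)]],
       rule Ck_on_add[OF V Ck_on_bilinear[OF V bounded_bilinear_scaleR C(3) D(1)]
          Ck_on_bilinear[OF V bounded_bilinear_scaleR C(4) D(2)]])
qed

lemma smooth_on_planeD:
  assumes "smooth_on_plane f U"
  shows "p \<in> U \<Longrightarrow> f differentiable (at p)" "smooth_on_plane (pd_u f) U"
    "smooth_on_plane (pd_v f) U" "continuous_on U f"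
proof -
  have C: "Ck_on (Suc n) f U" for n using assms unfolding smooth_on_plane_def by blast
  show "p \<in> U \<Longrightarrow> f differentiable (at p)" "smooth_on_plane (pd_u f) U" "smooth_on_plane (pd_v f) U"
    using C unfolding smooth_on_plane_def by auto
  show "continuous_on U f" using assms unfolding smooth_on_plane_def by (metis Ck_on.simps(1))
qed

lemma smooth_on_plane_cong:
  "open U \<Longrightarrow> (\<And>q. q \<in> U \<Longrightarrow> f q = g q) \<Longrightarrow> smooth_on_plane f U \<Longrightarrow> smooth_on_plane g U"
  unfolding smooth_on_plane_def using Ck_on_cong by blast

lemma smooth_on_plane_subset: "smooth_on_plane f U \<Longrightarrow> V \<subseteq> U \<Longrightarrow> smooth_on_plane f V"
  unfolding smooth_on_plane_def using Ck_on_subset by blast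

lemma smooth_const: "open U \<Longrightarrow> smooth_on_plane (\<lambda>_. c) U"
  by (simp add: smooth_on_plane_def Ck_on_const)

lemma smooth_bounded_linear:
  "open U \<Longrightarrow> bounded_linear L \<Longrightarrow> smooth_on_plane f U \<Longrightarrow> smooth_on_plane (\<lambda>p. L (f p)) U"
  by (simp add: smooth_on_plane_def Ck_on_bounded_linear)

lemma smooth_add:
  "open U \<Longrightarrow> smooth_on_plane f U \<Longrightarrow> smooth_on_plane g U \<Longrightarrow> smooth_on_plane (\<lambda>p. f p + g p) U"
  by (simp add: smooth_on_plane_def Ck_on_add)

lemma smooth_bilinear:
  "open U \<Longrightarrow> bounded_bilinear B \<Longrightarrow> smooth_on_plane f U \<Longrightarrow> smooth_on_plane g U
    \<Longrightarrow> smooth_on_plane (\<lambda>p. B (f p) (g p)) U"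
  by (simp add: smooth_on_plane_def Ck_on_bilinear)

lemma smooth_comp:
  "open V \<Longrightarrow> \<phi> ` V \<subseteq> U \<Longrightarrow> smooth_on_plane g U \<Longrightarrow> smooth_on_plane \<phi> V
    \<Longrightarrow> smooth_on_plane (\<lambda>p. g (\<phi> p)) V"
  unfolding smooth_on_plane_def using Ck_on_comp by blast

lemma smooth_minus:
  "open U \<Longrightarrow> smooth_on_plane f U \<Longrightarrow> smooth_on_plane (\<lambda>p. - f p) U"
  by (rule smooth_bounded_linear[OF _ bounded_linear_minus[OF bounded_linear_ident]])

lemma smooth_diff:
  "open U \<Longrightarrow> smooth_on_plane f U \<Longrightarrow> smooth_on_plane g U \<Longrightarrow> smooth_on_plane (\<lambda>p. f p - g p) U"
  using smooth_add[of U f "\<lambda>p. - g p"] smooth_minus[of U g] by simp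

lemma smooth_mult:
  fixes f :: "real \<times> real \<Rightarrow> real"
  shows "open U \<Longrightarrow> smooth_on_plane f U \<Longrightarrow> smooth_on_plane g U \<Longrightarrow> smooth_on_plane (\<lambda>p. f p * g p) U"
  by (rule smooth_bilinear[OF _ bounded_bilinear_mult])

lemma smooth_scaleR:
  "open U \<Longrightarrow> smooth_on_plane f U \<Longrightarrow> smooth_on_plane g U \<Longrightarrow> smooth_on_plane (\<lambda>p. f p *\<^sub>R g p) U"
  by (rule smooth_bilinear[OF _ bounded_bilinear_scaleR])

lemma smooth_divide:
  fixes f :: "real \<times> real \<Rightarrow> real"
  shows "open U \<Longrightarrow> (\<And>p. p \<in> U \<Longrightarrow> g p \<noteq> 0) \<Longrightarrow> smooth_on_plane f U \<Longrightarrow> smooth_on_plane g U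
    \<Longrightarrow> smooth_on_plane (\<lambda>p. f p / g p) U"
  unfolding divide_inverse
  by (rule smooth_mult) (auto simp: smooth_on_plane_def Ck_on_inverse)

lemma smooth_sqrt:
  "open U \<Longrightarrow> (\<And>p. p \<in> U \<Longrightarrow> f p > 0) \<Longrightarrow> smooth_on_plane f U \<Longrightarrow> smooth_on_plane (\<lambda>p. sqrt (f p)) U"
  by (simp add: smooth_on_plane_def Ck_on_sqrt)

lemma smooth_power2:
  fixes f :: "real \<times> real \<Rightarrow> real"
  shows "open U \<Longrightarrow> smooth_on_plane f U \<Longrightarrow> smooth_on_plane (\<lambda>p. (f p)\<^sup>2) U"
  unfolding power2_eq_square by (rule smooth_mult)

lemma smooth_Pair:
  assumes U: "open U" and "smooth_on_plane f U" "smooth_on_plane g U"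
  shows "smooth_on_plane (\<lambda>p. (f p, g p)) U"
proof -
  have L: "bounded_linear (\<lambda>x. (x, 0))" "bounded_linear (\<lambda>y. (0, y))"
    by (rule bounded_linear_Pair bounded_linear_ident bounded_linear_zero)+
  have "smooth_on_plane (\<lambda>p. (f p, 0) + (0, g p)) U"
    by (rule smooth_add[OF U smooth_bounded_linear[OF U L(1) assms(2)]
          smooth_bounded_linear[OF U L(2) assms(3)]])
  then show ?thesis by simp
qed

lemma smooth_on_planeI_potential:
  assumes U: "open U"
    and d: "\<And>p. p \<in> U \<Longrightarrow> (f has_derivative (\<lambda>h. fst h *\<^sub>R fu p + snd h *\<^sub>R fv p)) (at p)"
    and C: "smooth_on_plane fu U" "smooth_on_plane fv U"
  shows "smooth_on_plane f U"
  unfolding smooth_on_plane_def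
proof
  fix n
  have "Ck_on (Suc n) f U"
    by (rule Ck_on_SucI[OF U d]) (use C in \<open>simp_all add: smooth_on_plane_def\<close>)
  then show "Ck_on n f U" by (rule Ck_on_Suc_imp)
qed

section \<open>Mixed partial derivatives, potentials and local diffeomorphisms\<close>

lemma has_real_derivative_pd:
  fixes f :: "real \<times> real \<Rightarrow> real"
  assumes "f differentiable (at (x, y))"
  shows "((\<lambda>s. f (s, y)) has_real_derivative pd_u f (x, y)) (at x)"
    "((\<lambda>t. f (x, t)) has_real_derivative pd_v f (x, y)) (at y)"
proof -
  have "((\<lambda>s. f (s, y)) has_derivative (\<lambda>h. fst (h, 0::real) *\<^sub>R pd_u f (x, y)
      + snd (h, 0::real) *\<^sub>R pd_v f (x, y))) (at x)"
    by (rule has_derivative_compose[of "\<lambda>s. (s, y)", OF _ has_derivative_plane[OF assms]])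
      (auto intro!: derivative_eq_intros)
  then show "((\<lambda>s. f (s, y)) has_real_derivative pd_u f (x, y)) (at x)"
    by (simp add: has_field_derivative_def mult_commute_abs)
  have "((\<lambda>t. f (x, t)) has_derivative (\<lambda>h. fst (0::real, h) *\<^sub>R pd_u f (x, y)
      + snd (0::real, h) *\<^sub>R pd_v f (x, y))) (at y)"
    by (rule has_derivative_compose[of "\<lambda>t. (x, t)", OF _ has_derivative_plane[OF assms]])
      (auto intro!: derivative_eq_intros)
  then show "((\<lambda>t. f (x, t)) has_real_derivative pd_v f (x, y)) (at y)"
    by (simp add: has_field_derivative_def mult_commute_abs)
qed

lemma mixed_partials_real:
  fixes f :: "real \<times> real \<Rightarrow> real"
  assumes U: "open U" "p \<in> U" and f: "smooth_on_plane f U"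
  shows "pd_v (pd_u f) p = pd_u (pd_v f) p"
proof (rule ccontr)
  let ?a = "pd_v (pd_u f)" and ?b = "pd_u (pd_v f)"
  assume ne: "?a p \<noteq> ?b p"
  define e where "e = \<bar>?a p - ?b p\<bar> / 2"
  have e: "e > 0" using ne by (simp add: e_def)
  have cont: "continuous_on U ?a" "continuous_on U ?b"
    using smooth_on_planeD(4)[OF smooth_on_planeD(3)[OF smooth_on_planeD(2)[OF f]]]
      smooth_on_planeD(4)[OF smooth_on_planeD(2)[OF smooth_on_planeD(3)[OF f]]] .
  obtain d0 where d0: "d0 > 0" "ball p d0 \<subseteq> U" using U openE by blast
  obtain d1 where d1: "d1 > 0" "\<And>q. q \<in> U \<Longrightarrow> dist q p < d1 \<Longrightarrow> dist (?a q) (?a p) < e"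
    using cont(1) U(2) e unfolding continuous_on_iff by blast
  obtain d2 where d2: "d2 > 0" "\<And>q. q \<in> U \<Longrightarrow> dist q p < d2 \<Longrightarrow> dist (?b q) (?b p) < e"
    using cont(2) U(2) e unfolding continuous_on_iff by blast
  obtain x0 y0 where p: "p = (x0, y0)" by (cases p)
  define h where "h = min d0 (min d1 d2) / 3"
  have h: "h > 0" "3 * h \<le> d0" "3 * h \<le> d1" "3 * h \<le> d2"
    using d0 d1 d2 by (auto simp: h_def)
  have near: "(s, t) \<in> U \<and> dist (s, t) p < d1 \<and> dist (s, t) p < d2"
    if "x0 \<le> s" "s \<le> x0 + h" "y0 \<le> t" "t \<le> y0 + h" for s t
  proof -
    have "dist (s, t) p \<le> \<bar>s - x0\<bar> + \<bar>t - y0\<bar>"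
      using sqrt_sum_squares_le_sum_abs[of "s - x0" "t - y0"]
      by (simp add: p dist_Pair_Pair dist_real_def)
    then have "dist (s, t) p \<le> 2 * h" using that by simp
    then have "dist (s, t) p < d0" "dist (s, t) p < d1" "dist (s, t) p < d2" using h by auto
    then show ?thesis using d0(2) by (auto simp: dist_commute)
  qed
  have U': "(s, t) \<in> U" if "x0 \<le> s" "s \<le> x0 + h" "y0 \<le> t" "t \<le> y0 + h" for s t
    using near[OF that] by simp
  note D = has_real_derivative_pd[OF smooth_on_planeD(1)[OF f U']]
  note Du = has_real_derivative_pd[OF smooth_on_planeD(1)[OF smooth_on_planeD(2)[OF f] U']]
  note Dv = has_real_derivative_pd[OF smooth_on_planeD(1)[OF smooth_on_planeD(3)[OF f] U']]
  define S where "S = f (x0 + h, y0 + h) - f (x0 + h, y0) - f (x0, y0 + h) + f (x0, y0)"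
  \<comment> \<open>The mean value theorem, applied twice in either order, exhibits the second difference \<open>S\<close>
    as a value of each of the two mixed derivatives.\<close>
  have "((\<lambda>s. f (s, y0 + h) - f (s, y0)) has_real_derivative pd_u f (s, y0 + h) - pd_u f (s, y0)) (at s)"
    if "x0 \<le> s" "s \<le> x0 + h" for s
    by (rule DERIV_diff[OF D(1) D(1)]) (use that h in simp_all)
  then obtain s where s: "x0 < s" "s < x0 + h"
    "(f (x0 + h, y0 + h) - f (x0 + h, y0)) - (f (x0, y0 + h) - f (x0, y0))
      = (x0 + h - x0) * (pd_u f (s, y0 + h) - pd_u f (s, y0))"
    using MVT2[of x0 "x0 + h" "\<lambda>s. f (s, y0 + h) - f (s, y0)"
        "\<lambda>s. pd_u f (s, y0 + h) - pd_u f (s, y0)"] h by auto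
  obtain t where t: "y0 < t" "t < y0 + h" "pd_u f (s, y0 + h) - pd_u f (s, y0) = (y0 + h - y0) * ?a (s, t)"
    using MVT2[of y0 "y0 + h" "\<lambda>t. pd_u f (s, t)" "\<lambda>t. ?a (s, t)"] h Du(2) s by auto
  have "((\<lambda>t. f (x0 + h, t) - f (x0, t)) has_real_derivative pd_v f (x0 + h, t) - pd_v f (x0, t)) (at t)"
    if "y0 \<le> t" "t \<le> y0 + h" for t
    by (rule DERIV_diff[OF D(2) D(2)]) (use that h in simp_all)
  then obtain t' where t': "y0 < t'" "t' < y0 + h"
    "(f (x0 + h, y0 + h) - f (x0, y0 + h)) - (f (x0 + h, y0) - f (x0, y0))
      = (y0 + h - y0) * (pd_v f (x0 + h, t') - pd_v f (x0, t'))"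
    using MVT2[of y0 "y0 + h" "\<lambda>t. f (x0 + h, t) - f (x0, t)"
        "\<lambda>t. pd_v f (x0 + h, t) - pd_v f (x0, t)"] h by auto
  obtain s' where s': "x0 < s'" "s' < x0 + h"
    "pd_v f (x0 + h, t') - pd_v f (x0, t') = (x0 + h - x0) * ?b (s', t')"
    using MVT2[of x0 "x0 + h" "\<lambda>s. pd_v f (s, t')" "\<lambda>s. ?b (s, t')"] h Dv(1) t' by auto
  have "S = h * (h * ?a (s, t))" "S = h * (h * ?b (s', t'))"
    using s(3) t(3) t'(3) s'(3) by (simp_all add: S_def)
  then have "?a (s, t) = ?b (s', t')" using h by simp
  moreover have "\<bar>?a (s, t) - ?a p\<bar> < e" "\<bar>?b (s', t') - ?b p\<bar> < e"
    using d1(2)[of "(s, t)"] d2(2)[of "(s', t')"] near[of s t] near[of s' t'] s t s' t'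
    by (auto simp: dist_real_def)
  ultimately show False unfolding e_def by argo
qed

lemma pd_bounded_linear:
  assumes "bounded_linear L" "f differentiable (at p)"
  shows "pd_u (\<lambda>q. L (f q)) p = L (pd_u f p)" "pd_v (\<lambda>q. L (f q)) p = L (pd_v f p)"
proof -
  interpret L: bounded_linear L by (rule assms)
  note d = L.has_derivative[OF has_derivative_plane[OF assms(2)]]
  show "pd_u (\<lambda>q. L (f q)) p = L (pd_u f p)" "pd_v (\<lambda>q. L (f q)) p = L (pd_v f p)"
    using pd_eqI[OF d] by simp_all
qed

text \<open>The scalar case applies to every inner product with a fixed vector.\<close>

lemma mixed_partials:
  fixes f :: "real \<times> real \<Rightarrow> 'a::real_inner"
  assumes U: "open U" "p \<in> U" and f: "smooth_on_plane f U"
  shows "pd_v (pd_u f) p = pd_u (pd_v f) p"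
proof -
  have "pd_v (pd_u f) p \<bullet> c = pd_u (pd_v f) p \<bullet> c" for c
  proof -
    have L: "bounded_linear (\<lambda>x. x \<bullet> c)" by (rule bounded_linear_inner_left)
    have 1: "pd_u f q \<bullet> c = pd_u (\<lambda>q. f q \<bullet> c) q" "pd_v f q \<bullet> c = pd_v (\<lambda>q. f q \<bullet> c) q"
      if "q \<in> U" for q
      using pd_bounded_linear[OF L smooth_on_planeD(1)[OF f that]] by simp_all
    have d: "pd_u f differentiable (at p)" "pd_v f differentiable (at p)"
      using smooth_on_planeD(1)[OF smooth_on_planeD(2)[OF f] U(2)]
        smooth_on_planeD(1)[OF smooth_on_planeD(3)[OF f] U(2)] .
    have s: "smooth_on_plane (\<lambda>q. f q \<bullet> c) U" by (rule smooth_bounded_linear[OF U(1) L f])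
    have "pd_v (pd_u f) p \<bullet> c = pd_v (\<lambda>q. pd_u f q \<bullet> c) p"
      using pd_bounded_linear(2)[OF L d(1)] by simp
    also have "\<dots> = pd_v (pd_u (\<lambda>q. f q \<bullet> c)) p"
      using differentiable_plane_cong(3)[OF U, of "pd_u (\<lambda>q. f q \<bullet> c)" "\<lambda>q. pd_u f q \<bullet> c"] 1(1)
        smooth_on_planeD(1)[OF smooth_on_planeD(2)[OF s] U(2)] by simp
    also have "\<dots> = pd_u (pd_v (\<lambda>q. f q \<bullet> c)) p" by (rule mixed_partials_real[OF U s])
    also have "\<dots> = pd_u (\<lambda>q. pd_v f q \<bullet> c) p"
      using differentiable_plane_cong(2)[OF U, of "pd_v (\<lambda>q. f q \<bullet> c)" "\<lambda>q. pd_v f q \<bullet> c"] 1(2)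
        smooth_on_planeD(1)[OF smooth_on_planeD(3)[OF s] U(2)] by simp
    also have "\<dots> = pd_u (pd_v f) p \<bullet> c"
      using pd_bounded_linear(1)[OF L d(2)] by simp
    finally show ?thesis .
  qed
  then show ?thesis using vector_eq_rdot by blast
qed

text \<open>The Poincare lemma for one-forms \<open>P du + Q dv\<close>, in local form.  The potential integrates \<open>P\<close> along the
  lower edge of a square and then \<open>Q\<close> vertically; closedness is what turns the derivative of the
  second integral under the integral sign into a difference of values of \<open>P\<close>.  Starting at a corner of
  the square instead of its centre keeps both integrals over intervals of the usual orientation.\<close>

lemma closed_form_has_potential:
  fixes P Q :: "real \<times> real \<Rightarrow> real"
  assumes D: "open D" "p0 \<in> D" and PQ: "smooth_on_plane P D" "smooth_on_plane Q D"
    and closed: "\<And>p. p \<in> D \<Longrightarrow> pd_v P p = pd_u Q p"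
  obtains r f where "r > 0" "ball p0 r \<subseteq> D"
    "\<And>p. p \<in> ball p0 r \<Longrightarrow> (f has_derivative (\<lambda>h. fst h *\<^sub>R P p + snd h *\<^sub>R Q p)) (at p)"
proof -
  obtain x0 y0 where p0: "p0 = (x0, y0)" by (cases p0)
  obtain r0 where r0: "r0 > 0" "ball p0 r0 \<subseteq> D" using D openE by blast
  define r where "r = r0 / 3"
  have r: "r > 0" using r0 by (simp add: r_def)
  define a b c d where "a = x0 - r" "b = x0 + r" "c = y0 - r" "d = y0 + r"
  note defs = a_b_c_d_def
  have sub: "{a..b} \<times> {c..d} \<subseteq> D"
  proof
    fix q assume "q \<in> {a..b} \<times> {c..d}"
    then obtain s t where q: "q = (s, t)" "s \<in> {a..b}" "t \<in> {c..d}" by auto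
    have "dist q p0 \<le> \<bar>s - x0\<bar> + \<bar>t - y0\<bar>"
      using sqrt_sum_squares_le_sum_abs[of "s - x0" "t - y0"]
      by (simp add: p0 q dist_Pair_Pair dist_real_def)
    also have "\<dots> \<le> 2 * r" using q by (auto simp: defs)
    also have "\<dots> < r0" using r0 by (simp add: r_def)
    finally show "q \<in> D" using r0(2) by (auto simp: dist_commute)
  qed
  have subb: "ball p0 r \<subseteq> {a..b} \<times> {c..d}"
  proof
    fix q assume q: "q \<in> ball p0 r"
    obtain s t where st: "q = (s, t)" by (cases q)
    have "\<bar>s - x0\<bar> < r" "\<bar>t - y0\<bar> < r"
      using q dist_fst_le[of q p0] dist_snd_le[of q p0] by (auto simp: st p0 dist_real_def dist_commute)
    then show "q \<in> {a..b} \<times> {c..d}" by (auto simp: defs st)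
  qed
  have inD: "(s, t) \<in> D" if "s \<in> {a..b}" "t \<in> {c..d}" for s t using sub that by auto
  have contP: "continuous_on D P" "continuous_on D Q" "continuous_on D (pd_v P)" "continuous_on D (pd_u Q)"
    using PQ by (auto dest: smooth_on_planeD)
  have cc: "c \<in> {c..d}" using r by (simp add: defs)
  define f where "f x y = integral {a..x} (\<lambda>s. P (s, c)) + integral {c..y} (\<lambda>t. Q (x, t))" for x y
  have fx: "((\<lambda>x. f x y) has_derivative (\<lambda>h. h * P (x, y))) (at x within {a..b})"
    if x: "x \<in> {a..b}" and y: "y \<in> {c..d}" for x y
  proof -
    have yc: "t \<in> {c..d}" if "t \<in> {c..y}" for t using that y by auto
    have 1: "((\<lambda>x. integral {a..x} (\<lambda>s. P (s, c))) has_real_derivative P (x, c)) (at x within {a..b})"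
      by (rule integral_has_real_derivative[OF _ x])
        (rule continuous_on_compose2[OF contP(1)], auto intro!: continuous_intros inD cc)
    have "((\<lambda>x. integral (cbox c y) (\<lambda>t. Q (x, t))) has_real_derivative
        integral (cbox c y) (\<lambda>t. pd_u Q (x, t))) (at x within {a..b})"
    proof (rule leibniz_rule_field_derivative[of "{a..b}" c y "\<lambda>x t. Q (x, t)" "\<lambda>x t. pd_u Q (x, t)"])
      show "((\<lambda>x. Q (x, t)) has_real_derivative pd_u Q (x, t)) (at x within {a..b})"
        if "x \<in> {a..b}" "t \<in> cbox c y" for x t
        using has_real_derivative_pd(1)[OF smooth_on_planeD(1)[OF PQ(2)], of x t] inD[of x t] yc that
        by (auto intro: has_field_derivative_at_within)
      show "(\<lambda>t. Q (x, t)) integrable_on cbox c y" if "x \<in> {a..b}" for x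
        by (rule integrable_continuous, rule continuous_on_compose2[OF contP(2)])
          (use that in \<open>auto intro!: continuous_intros inD yc\<close>)
      show "continuous_on ({a..b} \<times> cbox c y) (\<lambda>(x, t). pd_u Q (x, t))"
        unfolding split_beta prod.collapse
        by (rule continuous_on_subset[OF contP(4)]) (auto intro!: inD yc)
    qed (use x in auto)
    moreover have "integral (cbox c y) (\<lambda>t. pd_u Q (x, t)) = P (x, y) - P (x, c)"
    proof -
      have "((\<lambda>t. pd_v P (x, t)) has_integral P (x, y) - P (x, c)) {c..y}"
      proof (rule fundamental_theorem_of_calculus)
        show "c \<le> y" using y by simp
        show "((\<lambda>t. P (x, t)) has_vector_derivative pd_v P (x, t)) (at t within {c..y})"
          if "t \<in> {c..y}" for t
          using has_real_derivative_pd(2)[OF smooth_on_planeD(1)[OF PQ(1)], of x t] inD[OF x yc[OF that]]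
          by (auto simp: has_real_derivative_iff_has_vector_derivative
              intro: has_vector_derivative_at_within)
      qed
      then have "((\<lambda>t. pd_u Q (x, t)) has_integral P (x, y) - P (x, c)) {c..y}"
        by (rule has_integral_eq[rotated]) (use closed inD[OF x yc] in auto)
      then show ?thesis by (simp add: integral_unique)
    qed
    ultimately have 2: "((\<lambda>x. integral {c..y} (\<lambda>t. Q (x, t))) has_real_derivative
        P (x, y) - P (x, c)) (at x within {a..b})"
      by simp
    have "((\<lambda>x. f x y) has_real_derivative P (x, c) + (P (x, y) - P (x, c))) (at x within {a..b})"
      unfolding f_def by (rule DERIV_add[OF 1 2])
    then show ?thesis by (simp add: has_field_derivative_def mult_commute_abs)
  qed
  have fy: "((\<lambda>y. f x y) has_derivative blinfun_apply (blinfun_mult_right (Q (x, y)))) (at y within {c..d})"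
    if x: "x \<in> {a..b}" and y: "y \<in> {c..d}" for x y
  proof -
    have "((\<lambda>y. integral {c..y} (\<lambda>t. Q (x, t))) has_real_derivative Q (x, y)) (at y within {c..d})"
      by (rule integral_has_real_derivative[OF _ y])
        (rule continuous_on_compose2[OF contP(2)], auto intro!: continuous_intros inD x)
    then have "((\<lambda>y. f x y) has_real_derivative 0 + Q (x, y)) (at y within {c..d})"
      unfolding f_def by (intro DERIV_add DERIV_const)
    then show ?thesis by (simp add: has_field_derivative_def)
  qed
  have fyc: "continuous_on ({a..b} \<times> {c..d}) (\<lambda>(x, y). blinfun_mult_right (Q (x, y)))"
    unfolding split_beta prod.collapse
    by (rule bounded_linear.continuous_on[OF bounded_linear_blinfun_mult_right])
      (rule continuous_on_subset[OF contP(2) sub])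
  have "((\<lambda>(x, y). f x y) has_derivative (\<lambda>h. fst h *\<^sub>R P p + snd h *\<^sub>R Q p)) (at p)"
    if p: "p \<in> ball p0 r" for p
  proof -
    obtain x y where xy: "p = (x, y)" by (cases p)
    have x: "x \<in> {a..b}" and y: "y \<in> {c..d}" using subb p xy by auto
    have "((\<lambda>(x, y). f x y) has_derivative
        (\<lambda>(tx, ty). tx * P (x, y) + blinfun_apply (blinfun_mult_right (Q (x, y))) ty))
        (at (x, y) within {a..b} \<times> {c..d})"
    proof (rule has_derivative_partialsI[OF fx[OF x y] fy])
      show "continuous (at (x, y) within {a..b} \<times> {c..d}) (\<lambda>(x, y). blinfun_mult_right (Q (x, y)))"
        using fyc x y unfolding continuous_on_eq_continuous_within by blast
    qed (use y in auto)
    then have "((\<lambda>(x, y). f x y) has_derivative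
        (\<lambda>(tx, ty). tx * P (x, y) + blinfun_apply (blinfun_mult_right (Q (x, y))) ty))
        (at (x, y) within ball p0 r)"
      by (rule has_derivative_subset[OF _ subb])
    then have "((\<lambda>(x, y). f x y) has_derivative
        (\<lambda>(tx, ty). tx * P (x, y) + blinfun_apply (blinfun_mult_right (Q (x, y))) ty)) (at p)"
      using at_within_open[OF p open_ball] by (simp add: xy)
    then show ?thesis
      by (rule has_derivative_eq_rhs) (simp add: xy fun_eq_iff)
  qed
  then show thesis using that[of r "\<lambda>(x, y). f x y"] r subb sub by blast
qed


text \<open>The inverse function theorem for a map with derivative \<open>A du + B dv\<close>, including smoothness of the
  inverse.  The last two conclusions say that the columns of the derivative of the inverse are dual to the
  pair \<open>A, B\<close>; this is the form in which the change of parameters is used.\<close>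

lemma local_diffeo:
  fixes \<Phi> :: "real \<times> real \<Rightarrow> real \<times> real"
  assumes D: "open D" "p0 \<in> D"
    and d: "\<And>p. p \<in> D \<Longrightarrow> (\<Phi> has_derivative (\<lambda>h. fst h *\<^sub>R A p + snd h *\<^sub>R B p)) (at p)"
    and AB: "smooth_on_plane A D" "smooth_on_plane B D"
    and det: "\<And>p. p \<in> D \<Longrightarrow> fst (A p) * snd (B p) - snd (A p) * fst (B p) \<noteq> 0"
  obtains U V \<phi> where "p0 \<in> U" "U \<subseteq> D" "plane_domain U" "plane_domain V" "plane_diffeo \<phi> V U"
    "\<And>q. q \<in> V \<Longrightarrow> \<phi> q \<in> U"
    "\<And>q. q \<in> V \<Longrightarrow> fst (pd_u \<phi> q) *\<^sub>R A (\<phi> q) + snd (pd_u \<phi> q) *\<^sub>R B (\<phi> q) = (1, 0)"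
    "\<And>q. q \<in> V \<Longrightarrow> fst (pd_v \<phi> q) *\<^sub>R A (\<phi> q) + snd (pd_v \<phi> q) *\<^sub>R B (\<phi> q) = (0, 1)"
proof -
  define J where "J p = fst (A p) * snd (B p) - snd (A p) * fst (B p)" for p
  define f' where "f' p = (blinfun_scaleR_left (A p) o\<^sub>L fst_blinfun) + (blinfun_scaleR_left (B p) o\<^sub>L snd_blinfun)" for p
  have f'_apply: "blinfun_apply (f' p) = (\<lambda>h. fst h *\<^sub>R A p + snd h *\<^sub>R B p)" for p
    by (auto simp: f'_def blinfun.add_left)
  have contf': "continuous_on D f'"
    unfolding f'_def
    by (intro continuous_on_add bounded_bilinear.continuous_on[OF bounded_bilinear_blinfun_compose]
        bounded_linear.continuous_on[OF bounded_linear_blinfun_scaleR_left] continuous_on_const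
        smooth_on_planeD(4)[OF AB(1)] smooth_on_planeD(4)[OF AB(2)])
  define Ainv Binv where "Ainv p = (snd (B p) / J p, - snd (A p) / J p)"
    and "Binv p = (- fst (B p) / J p, fst (A p) / J p)" for p
  have Jnz: "J p \<noteq> 0" if "p \<in> D" for p using det[OF that] by (simp add: J_def)
  define invf where "invf = (blinfun_scaleR_left (Ainv p0) o\<^sub>L fst_blinfun) + (blinfun_scaleR_left (Binv p0) o\<^sub>L snd_blinfun)"
  have inv: "invf o\<^sub>L f' p0 = id_blinfun"
  proof (rule blinfun_eqI)
    fix h :: "real \<times> real"
    show "blinfun_apply (invf o\<^sub>L f' p0) h = blinfun_apply id_blinfun h"
      using Jnz[OF D(2)]
      by (auto simp: f'_apply invf_def blinfun.add_left Ainv_def Binv_def prod_eq_iff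
        simp flip: add_divide_distrib diff_divide_distrib)
        (auto simp: J_def divide_eq_eq algebra_simps)
  qed
  have d': "(\<Phi> has_derivative blinfun_apply (f' p)) (at p)" if "p \<in> D" for p
    unfolding f'_apply by (rule d[OF that])
  obtain U' V' g where U': "open U'" "U' \<subseteq> D" "p0 \<in> U'" "open V'" and hom: "homeomorphism U' V' \<Phi> g"
    and g: "\<And>y. y \<in> V' \<Longrightarrow> g differentiable (at y)"
  proof (rule inverse_function_theorem[OF D(1) d' contf' D(2) inv])
    fix U' V' g g'
    assume a: "open U'" "U' \<subseteq> D" "p0 \<in> U'" "open V'" "homeomorphism U' V' \<Phi> g"
      and g: "\<And>y. y \<in> V' \<Longrightarrow> (g has_derivative (g' y)) (at y)"
    have "g differentiable (at y)" if "y \<in> V'" for y by (rule differentiableI[OF g[OF that]])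
    then show thesis by (rule that[OF a])
  qed
  obtain r where r: "r > 0" "ball p0 r \<subseteq> U'" using U' openE by blast
  define U where "U = ball p0 r"
  define V where "V = V' \<inter> g -` U"
  have V: "open V"
    unfolding V_def U_def using hom U'(4)
    by (intro continuous_open_preimage) (auto simp: homeomorphism_def)
  have gV: "g q \<in> U" "g q \<in> D" "q \<in> V'" "\<Phi> (g q) = q" if "q \<in> V" for q
    using that r U' hom by (auto simp: V_def U_def homeomorphism_def)
  have \<Phi>U: "\<Phi> p \<in> V" "g (\<Phi> p) = p" if "p \<in> U" for p
    using that r hom by (auto simp: V_def U_def homeomorphism_def)
  have VU: "V = \<Phi> ` U"
  proof
    show "V \<subseteq> \<Phi> ` U"
    proof
      fix q assume q: "q \<in> V"
      then have "q = \<Phi> (g q)" "g q \<in> U" using gV(1,4) by simp_all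
      then show "q \<in> \<Phi> ` U" by (rule image_eqI)
    qed
    show "\<Phi> ` U \<subseteq> V" by (rule image_subsetI) (rule \<Phi>U(1))
  qed
  have UD: "U \<subseteq> D" using r U' by (auto simp: U_def)
  have "\<Phi> differentiable (at p)" if "p \<in> D" for p
    using d[OF that] by (rule differentiableI)
  note \<Phi>d = this
  have pd\<Phi>: "pd_u \<Phi> p = A p" "pd_v \<Phi> p = B p" if "p \<in> D" for p
    using pd_eqI[OF d[OF that]] by simp_all
  have gd: "g differentiable (at q)" if "q \<in> V" for q
    by (rule g[OF gV(3)[OF that]])
  have chain: "fst (pd_u g q) *\<^sub>R A (g q) + snd (pd_u g q) *\<^sub>R B (g q) = (1, 0)"
    "fst (pd_v g q) *\<^sub>R A (g q) + snd (pd_v g q) *\<^sub>R B (g q) = (0, 1)" if q: "q \<in> V" for q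
  proof -
    note c = pd_comp[OF \<Phi>d[OF gV(2)[OF q]] gd[OF q]]
    have i: "pd_u (\<lambda>q. q) q = (1, 0)" "pd_v (\<lambda>q. q) q = (0, 1)" for q :: "real \<times> real"
      using pd_eqI[OF has_derivative_ident] by simp_all
    have "pd_u (\<lambda>q. \<Phi> (g q)) q = (1, 0)" "pd_v (\<lambda>q. \<Phi> (g q)) q = (0, 1)"
      using differentiable_plane_cong(2,3)[OF V q, of "\<lambda>q. \<Phi> (g q)" "\<lambda>q. q"] gV(4) c(3) i by simp_all
    then show "fst (pd_u g q) *\<^sub>R A (g q) + snd (pd_u g q) *\<^sub>R B (g q) = (1, 0)"
      "fst (pd_v g q) *\<^sub>R A (g q) + snd (pd_v g q) *\<^sub>R B (g q) = (0, 1)"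
      using c(1,2) pd\<Phi>[OF gV(2)[OF q]] by simp_all
  qed
  \<comment> \<open>Cramer's rule expresses the derivatives of the inverse map as smooth functions composed with it,
    which bootstraps its regularity.\<close>
  have pdg: "pd_u g q = Ainv (g q)" "pd_v g q = Binv (g q)" if q: "q \<in> V" for q
  proof -
    let ?p = "g q"
    have nz: "J ?p \<noteq> 0" by (rule Jnz[OF gV(2)[OF q]])
    have e: "fst (pd_u g q) * fst (A ?p) + snd (pd_u g q) * fst (B ?p) = 1"
      "fst (pd_u g q) * snd (A ?p) + snd (pd_u g q) * snd (B ?p) = 0"
      "fst (pd_v g q) * fst (A ?p) + snd (pd_v g q) * fst (B ?p) = 0"
      "fst (pd_v g q) * snd (A ?p) + snd (pd_v g q) * snd (B ?p) = 1"
      using chain[OF q] by (simp_all add: prod_eq_iff)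
    have "fst (pd_u g q) * J ?p = snd (B ?p)" "snd (pd_u g q) * J ?p = - snd (A ?p)"
      "fst (pd_v g q) * J ?p = - fst (B ?p)" "snd (pd_v g q) * J ?p = fst (A ?p)"
      unfolding J_def using e by algebra+
    then show "pd_u g q = Ainv ?p" "pd_v g q = Binv ?p"
      using nz by (auto simp: Ainv_def Binv_def prod_eq_iff eq_divide_eq simp del: divide_minus_left)
  qed
  have sm: "smooth_on_plane Ainv D" "smooth_on_plane Binv D"
  proof -
    have c: "smooth_on_plane (\<lambda>p. fst (A p)) D" "smooth_on_plane (\<lambda>p. snd (A p)) D"
      "smooth_on_plane (\<lambda>p. fst (B p)) D" "smooth_on_plane (\<lambda>p. snd (B p)) D"
      by (rule smooth_bounded_linear[OF D(1)] bounded_linear_fst bounded_linear_snd AB)+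
    have J: "smooth_on_plane (\<lambda>p. J p) D"
      unfolding J_def by (rule smooth_diff smooth_mult D c)+
    show "smooth_on_plane Ainv D" "smooth_on_plane Binv D"
      unfolding Ainv_def Binv_def
      by (rule smooth_Pair smooth_divide[OF _ Jnz _ J] smooth_minus D c | assumption)+
  qed
  have dg: "(g has_derivative (\<lambda>h. fst h *\<^sub>R Ainv (g q) + snd h *\<^sub>R Binv (g q))) (at q)"
    if "q \<in> V" for q
    using has_derivative_plane[OF gd[OF that]] unfolding pdg[OF that] .
  have gD: "g ` V \<subseteq> D" by (rule image_subsetI) (rule gV(2))
  have "Ck_on n g V" for n
  proof (induction n)
    case 0
    then show ?case
      using gd by (simp add: differentiable_imp_continuous_within continuous_at_imp_continuous_on)
  next
    case (Suc n)
    have C: "Ck_on n (\<lambda>q. Ainv (g q)) V" "Ck_on n (\<lambda>q. Binv (g q)) V"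
      using sm unfolding smooth_on_plane_def
      by (auto intro: Ck_on_comp[OF V gD _ Suc])
    show ?case
      by (rule Ck_on_SucI[OF V, where fu = "\<lambda>q. Ainv (g q)" and fv = "\<lambda>q. Binv (g q)", OF dg C])
  qed
  then have gs: "smooth_on_plane g V" by (simp add: smooth_on_plane_def)
  have \<Phi>s: "smooth_on_plane \<Phi> U"
    by (rule smooth_on_plane_subset[OF smooth_on_planeI_potential[OF D(1) d AB] UD])
  have bij: "bij_betw g V U"
    by (rule bij_betw_byWitness[of _ \<Phi>]) (simp_all add: gV(4) \<Phi>U image_subset_iff gV(1))
  have "inv_into V g p = \<Phi> p" if "p \<in> U" for p
    using bij_betw_inv_into_left[OF bij \<Phi>U(1)[OF that]] \<Phi>U(2)[OF that] by simp
  then have "smooth_on_plane (inv_into V g) U"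
    using smooth_on_plane_cong[OF _ _ \<Phi>s, of "inv_into V g"] by (simp add: U_def)
  then have diffeo: "plane_diffeo g V U"
    using bij gs by (simp add: plane_diffeo_def)
  have domU: "plane_domain U" by (simp add: plane_domain_def U_def)
  have domV: "plane_domain V"
    using V domU connected_continuous_image[OF smooth_on_planeD(4)[OF \<Phi>s]]
    by (simp add: plane_domain_def VU)
  have p0: "p0 \<in> U" using r by (simp add: U_def)
  show thesis by (rule that[OF p0 UD domU domV diffeo gV(1) chain])
qed

section \<open>Linear algebra of the neutral metric\<close>

interpretation nmetric: bounded_bilinear nmetric
  unfolding bilinear_conv_bounded_bilinear[symmetric] bilinear_def
  by (intro conjI allI linearI) (simp_all add: nmetric_def algebra_simps)

lemma nmetric_commute: "nmetric x y = nmetric y x"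
  by (simp add: nmetric_def algebra_simps)

lemmas nmetric_linear = nmetric.add_left nmetric.add_right nmetric.diff_left nmetric.diff_right
  nmetric.scaleR_left nmetric.scaleR_right nmetric.minus_left nmetric.minus_right

lemma vector_4_nth [simp]:
  fixes a b c d :: "'a::zero"
  shows "(vector [a, b, c, d] :: 'a^4) $ 1 = a" "(vector [a, b, c, d] :: 'a^4) $ 2 = b"
    "(vector [a, b, c, d] :: 'a^4) $ 3 = c" "(vector [a, b, c, d] :: 'a^4) $ 4 = d"
  unfolding vector_def by simp_all

definition nflip :: "real^4 \<Rightarrow> real^4" where
  "nflip x = vector [x$1, x$2, - x$3, - x$4]"

lemma nmetric_inner: "nmetric x y = x \<bullet> nflip y"
  by (simp add: nmetric_def nflip_def inner_vec_def sum_4)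

lemma nflip_eq_0: "nflip x = 0 \<Longrightarrow> x = 0"
  by (simp add: nflip_def vec_eq_iff forall_4)

lemma det_vector_4_minus:
  fixes a b c d :: "real^4"
  shows "det (vector [a, b, c, - d] :: real^4^4) = - det (vector [a, b, c, d] :: real^4^4)"
    "det (vector [a, b, - c, d] :: real^4^4) = - det (vector [a, b, c, d] :: real^4^4)"
proof -
  let ?M = "vector [a, b, c, d] :: real^4^4"
  have 4: "(\<chi> i. if i = 4 then (- 1) *s ?M $ i else ?M $ i) = (vector [a, b, c, - d] :: real^4^4)"
    "(\<chi> i. if i = 4 then ?M $ i else ?M $ i) = ?M"
    "(\<chi> i. if i = 3 then (- 1) *s ?M $ i else ?M $ i) = (vector [a, b, - c, d] :: real^4^4)"
    "(\<chi> i. if i = 3 then ?M $ i else ?M $ i) = ?M"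
    by (simp_all add: vec_eq_iff forall_4)
  show "det (vector [a, b, c, - d] :: real^4^4) = - det ?M"
    using det_row_mul[of 4 "- 1" "\<lambda>i. ?M $ i" "\<lambda>i. ?M $ i"] unfolding 4 by simp
  show "det (vector [a, b, - c, d] :: real^4^4) = - det ?M"
    using det_row_mul[of 3 "- 1" "\<lambda>i. ?M $ i" "\<lambda>i. ?M $ i"] unfolding 4 by simp
qed

text \<open>A basis of the ambient space that consists of a nondegenerate pair \<open>a, b\<close> (tangent vectors) and of two
  orthogonal non-null vectors \<open>c, d\<close> normal to it.  Vectors are compared by their products with
  these four.\<close>

locale split_frame =
  fixes a b c d :: "real^4"
  assumes tangent_nondeg: "nmetric a a * nmetric b b - (nmetric a b)\<^sup>2 \<noteq> 0"
    and orth: "nmetric c a = 0" "nmetric c b = 0" "nmetric d a = 0" "nmetric d b = 0" "nmetric c d = 0"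
    and normal_nondeg: "nmetric c c \<noteq> 0" "nmetric d d \<noteq> 0"
begin

lemma orth': "nmetric a c = 0" "nmetric b c = 0" "nmetric a d = 0" "nmetric b d = 0" "nmetric d c = 0"
  using orth by (simp_all add: nmetric_commute)

text \<open>The dual basis with respect to the metric provides the columns of an inverse matrix.\<close>

lemma right_inverse: "\<exists>B. (vector [a, b, c, d] :: real^4^4) ** B = mat 1"
proof -
  let ?Q = "nmetric a a * nmetric b b - (nmetric a b)\<^sup>2"
  define a' where "a' = (1 / ?Q) *\<^sub>R (nmetric b b *\<^sub>R a - nmetric a b *\<^sub>R b)"
  define b' where "b' = (1 / ?Q) *\<^sub>R (nmetric a a *\<^sub>R b - nmetric a b *\<^sub>R a)"
  define c' where "c' = (1 / nmetric c c) *\<^sub>R c"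
  define d' where "d' = (1 / nmetric d d) *\<^sub>R d"
  note defs = a'_def b'_def c'_def d'_def
  have dual: "nmetric a a' = 1" "nmetric a b' = 0" "nmetric a c' = 0" "nmetric a d' = 0"
    "nmetric b a' = 0" "nmetric b b' = 1" "nmetric b c' = 0" "nmetric b d' = 0"
    "nmetric c a' = 0" "nmetric c b' = 0" "nmetric c c' = 1" "nmetric c d' = 0"
    "nmetric d a' = 0" "nmetric d b' = 0" "nmetric d c' = 0" "nmetric d d' = 1"
    using tangent_nondeg normal_nondeg orth orth'
    by (simp_all add: defs nmetric_linear nmetric_commute[of b a] power2_eq_square mult.commute)
  let ?A = "vector [a, b, c, d] :: real^4^4"
  let ?C = "vector [nflip a', nflip b', nflip c', nflip d'] :: real^4^4"
  have "(?A ** transpose ?C) $ i $ j = ?A $ i \<bullet> ?C $ j" for i j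
    by (simp add: matrix_matrix_mult_def transpose_def inner_vec_def)
  then have "?A ** transpose ?C = mat 1"
    by (simp add: vec_eq_iff forall_4 mat_def flip: nmetric_inner) (simp add: dual)
  then show ?thesis by blast
qed

lemma det_nonzero: "det (vector [a, b, c, d] :: real^4^4) \<noteq> 0"
  using right_inverse invertible_right_inverse invertible_det_nz by blast

lemma eq_zeroI:
  assumes "nmetric a v = 0" "nmetric b v = 0" "nmetric c v = 0" "nmetric d v = 0"
  shows "v = 0"
proof -
  let ?A = "vector [a, b, c, d] :: real^4^4"
  obtain B where B: "B ** ?A = mat 1" using right_inverse matrix_left_right_inverse by blast
  have "?A *v nflip v = 0"
    using assms by (simp add: vec_eq_iff forall_4 matrix_vector_mul_component nmetric_inner)
  then have "B *v (?A *v nflip v) = 0" by simp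
  then have "nflip v = 0" by (simp add: matrix_vector_mul_assoc B)
  then show ?thesis by (rule nflip_eq_0)
qed

lemma eqI:
  assumes "nmetric v a = nmetric w a" "nmetric v b = nmetric w b"
    "nmetric v c = nmetric w c" "nmetric v d = nmetric w d"
  shows "v = w"
proof -
  have "v - w = 0"
    by (rule eq_zeroI) (use assms in \<open>simp_all add: nmetric_linear nmetric_commute\<close>)
  then show ?thesis by simp
qed

lemma normal_expansion:
  assumes "nmetric v a = 0" "nmetric v b = 0"
  shows "v = (nmetric v c / nmetric c c) *\<^sub>R c + (nmetric v d / nmetric d d) *\<^sub>R d"
  by (rule eqI) (use assms orth orth' normal_nondeg in \<open>simp_all add: nmetric_linear\<close>)

end

text \<open>The vector dual to the functional \<open>w \<mapsto> det (x, y, n, w)\<close>, written out in minors.\<close>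

definition minor3 :: "real^4 \<Rightarrow> real^4 \<Rightarrow> real^4 \<Rightarrow> 4 \<Rightarrow> 4 \<Rightarrow> 4 \<Rightarrow> real" where
  "minor3 x y n i j k = x$i * (y$j * n$k - y$k * n$j) - x$j * (y$i * n$k - y$k * n$i)
     + x$k * (y$i * n$j - y$j * n$i)"

definition ncross :: "real^4 \<Rightarrow> real^4 \<Rightarrow> real^4 \<Rightarrow> real^4" where
  "ncross x y n = (- minor3 x y n 2 3 4) *\<^sub>R axis 1 1 + minor3 x y n 1 3 4 *\<^sub>R axis 2 1
     + minor3 x y n 1 2 4 *\<^sub>R axis 3 1 + (- minor3 x y n 1 2 3) *\<^sub>R axis 4 1"

lemma ncross_nth:
  "ncross x y n $ 1 = - minor3 x y n 2 3 4" "ncross x y n $ 2 = minor3 x y n 1 3 4"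
  "ncross x y n $ 3 = minor3 x y n 1 2 4" "ncross x y n $ 4 = - minor3 x y n 1 2 3"
  by (simp_all add: ncross_def axis_def)

lemma ncross_orth:
  "nmetric (ncross x y n) x = 0" "nmetric (ncross x y n) y = 0" "nmetric (ncross x y n) n = 0"
  by (simp_all add: nmetric_def ncross_nth minor3_def algebra_simps)

text \<open>The square of the vector product is the Gram determinant, here of a triple whose last member is
  orthogonal to the other two.  The sign is that of the determinant of the metric, which is \<open>1\<close>.\<close>

lemma ncross_norm:
  assumes "nmetric x n = 0" "nmetric y n = 0"
  shows "nmetric (ncross x y n) (ncross x y n)
    = (nmetric x x * nmetric y y - (nmetric x y)\<^sup>2) * nmetric n n"
proof -
  have "nmetric (ncross x y n) (ncross x y n)
    = nmetric x x * (nmetric y y * nmetric n n - (nmetric y n)\<^sup>2)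
      - nmetric x y * (nmetric x y * nmetric n n - nmetric x n * nmetric y n)
      + nmetric x n * (nmetric x y * nmetric y n - nmetric x n * nmetric y y)"
    unfolding nmetric_def ncross_nth minor3_def by algebra
  then show ?thesis using assms by (simp add: power2_eq_square algebra_simps)
qed

section \<open>Normal parts, second fundamental form and mean curvature\<close>

definition gram :: "(real \<times> real \<Rightarrow> real^4) \<Rightarrow> real \<times> real \<Rightarrow> real" where
  "gram z p = coeff_E z p * coeff_G z p - (coeff_F z p)\<^sup>2"

lemma gram_neg: "admissible_at z p \<Longrightarrow> gram z p < 0"
  unfolding gram_def admissible_at_def
  by (smt (verit) mult_pos_neg zero_le_power2)

lemma in_span_pair: "x \<in> span {a, b} \<longleftrightarrow> (\<exists>r s. x = r *\<^sub>R a + s *\<^sub>R b)"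
  for x :: "'a::real_vector"
  by (auto simp: span_insert span_singleton algebra_simps)

lemma tangent_normal_zero:
  assumes "admissible_at z p" "normal_at z p n" "n \<in> span {pd_u z p, pd_v z p}"
  shows "n = 0"
proof -
  obtain r s where n: "n = r *\<^sub>R pd_u z p + s *\<^sub>R pd_v z p"
    using assms(3) by (auto simp: in_span_pair)
  have 1: "r * coeff_E z p + s * coeff_F z p = 0" "r * coeff_F z p + s * coeff_G z p = 0"
    using assms(2) unfolding normal_at_def n coeff_E_def coeff_F_def coeff_G_def
    by (simp_all add: nmetric_linear nmetric_commute[of "pd_v z p" "pd_u z p"])
  have "r * gram z p = 0" "s * gram z p = 0" using 1 unfolding gram_def by algebra+
  then show ?thesis using gram_neg[OF assms(1)] n by simp
qed

lemma normal_part_eq: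
  assumes "admissible_at z p" "normal_at z p n" "w - n \<in> span {pd_u z p, pd_v z p}"
  shows "normal_part z p w = n"
  unfolding normal_part_def
proof (rule the_equality)
  fix n' assume n': "normal_at z p n' \<and> w - n' \<in> span {pd_u z p, pd_v z p}"
  have "(w - n) - (w - n') \<in> span {pd_u z p, pd_v z p}"
    using assms(3) n' by (blast intro: span_diff)
  moreover have "normal_at z p (n' - n)"
    using assms(2) n' by (simp add: normal_at_def nmetric_linear)
  ultimately have "n' - n = 0" by (intro tangent_normal_zero[OF assms(1)]) simp_all
  then show "n' = n" by simp
qed (use assms in simp)

lemma normal_part_normal:
  assumes "admissible_at z p"
  shows "normal_at z p (normal_part z p w)" "w - normal_part z p w \<in> span {pd_u z p, pd_v z p}"
proof -
  let ?a = "pd_u z p" and ?b = "pd_v z p"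
  let ?E = "coeff_E z p" and ?F = "coeff_F z p" and ?G = "coeff_G z p" and ?Q = "gram z p"
  define r where "r = (nmetric w ?a * ?G - nmetric w ?b * ?F) / ?Q"
  define s where "s = (nmetric w ?b * ?E - nmetric w ?a * ?F) / ?Q"
  define n where "n = w - (r *\<^sub>R ?a + s *\<^sub>R ?b)"
  have Q: "?Q \<noteq> 0" using gram_neg[OF assms] by simp
  have "r * ?Q = nmetric w ?a * ?G - nmetric w ?b * ?F" "s * ?Q = nmetric w ?b * ?E - nmetric w ?a * ?F"
    using Q by (simp_all add: r_def s_def)
  then have "(r * ?E + s * ?F - nmetric w ?a) * ?Q = 0" "(r * ?F + s * ?G - nmetric w ?b) * ?Q = 0"
    unfolding gram_def by algebra+
  then have "nmetric w ?a = r * ?E + s * ?F" "nmetric w ?b = r * ?F + s * ?G" using Q by simp_all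
  then have "normal_at z p n"
    by (simp add: n_def normal_at_def nmetric_linear coeff_E_def coeff_F_def coeff_G_def
        nmetric_commute[of ?b ?a])
  moreover have "w - n \<in> span {?a, ?b}"
    unfolding in_span_pair n_def by (intro exI[of _ r] exI[of _ s]) simp
  ultimately show "normal_at z p (normal_part z p w)" "w - normal_part z p w \<in> span {?a, ?b}"
    using normal_part_eq[OF assms] by simp_all
qed

lemma nmetric_normal_part:
  assumes "admissible_at z p" "normal_at z p n"
  shows "nmetric (normal_part z p w) n = nmetric w n"
proof -
  obtain r s where "w - normal_part z p w = r *\<^sub>R pd_u z p + s *\<^sub>R pd_v z p"
    using normal_part_normal(2)[OF assms(1), of w] by (auto simp: in_span_pair)
  then have "nmetric (w - normal_part z p w) n = 0"
    using assms(2) by (simp add: normal_at_def nmetric_linear nmetric_commute[of _ n])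
  then show ?thesis by (simp add: nmetric_linear)
qed

lemma normal_part_linear:
  assumes "admissible_at z p"
  shows "normal_part z p (w - w') = normal_part z p w - normal_part z p w'"
    "normal_part z p (r *\<^sub>R w) = r *\<^sub>R normal_part z p w"
proof -
  note np = normal_part_normal[OF assms]
  have "normal_at z p (normal_part z p w - normal_part z p w')"
    "normal_at z p (r *\<^sub>R normal_part z p w)"
    using np(1)[of w] np(1)[of w'] by (simp_all add: normal_at_def nmetric_linear)
  moreover have "(w - w') - (normal_part z p w - normal_part z p w') \<in> span {pd_u z p, pd_v z p}"
    using span_diff[OF np(2)[of w] np(2)[of w']] by (simp add: algebra_simps)
  moreover have "r *\<^sub>R w - r *\<^sub>R normal_part z p w \<in> span {pd_u z p, pd_v z p}"
    using span_scale[OF np(2)[of w], of r] by (simp add: algebra_simps)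
  ultimately show "normal_part z p (w - w') = normal_part z p w - normal_part z p w'"
    "normal_part z p (r *\<^sub>R w) = r *\<^sub>R normal_part z p w"
    using normal_part_eq[OF assms] by blast+
qed

lemma sff_eq:
  assumes U: "open U" "p \<in> U" and z: "smooth_on_plane z U"
  shows "sff z p \<xi> \<eta> = normal_part z p ((fst \<xi> * fst \<eta>) *\<^sub>R pd_u (pd_u z) p
      + (fst \<xi> * snd \<eta> + snd \<xi> * fst \<eta>) *\<^sub>R pd_v (pd_u z) p + (snd \<xi> * snd \<eta>) *\<^sub>R pd_v (pd_v z) p)"
proof -
  note zu = smooth_on_planeD(1)[OF smooth_on_planeD(2)[OF z] U(2)]
  note zv = smooth_on_planeD(1)[OF smooth_on_planeD(3)[OF z] U(2)]
  have t: "fst \<eta> *\<^sub>R pd_u z q + snd \<eta> *\<^sub>R pd_v z q = tangent z q \<eta>" if "q \<in> U" for q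
    using frechet_derivative_plane[OF smooth_on_planeD(1)[OF z that]] by (simp add: tangent_def)
  have "((\<lambda>q. fst \<eta> *\<^sub>R pd_u z q + snd \<eta> *\<^sub>R pd_v z q) has_derivative
     (\<lambda>h. fst \<eta> *\<^sub>R (fst h *\<^sub>R pd_u (pd_u z) p + snd h *\<^sub>R pd_v (pd_u z) p)
        + snd \<eta> *\<^sub>R (fst h *\<^sub>R pd_u (pd_v z) p + snd h *\<^sub>R pd_v (pd_v z) p))) (at p)"
    by (rule has_derivative_add has_derivative_scaleR_right has_derivative_plane zu zv)+
  then have "((\<lambda>q. tangent z q \<eta>) has_derivative
     (\<lambda>h. fst \<eta> *\<^sub>R (fst h *\<^sub>R pd_u (pd_u z) p + snd h *\<^sub>R pd_v (pd_u z) p)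
        + snd \<eta> *\<^sub>R (fst h *\<^sub>R pd_u (pd_v z) p + snd h *\<^sub>R pd_v (pd_v z) p))) (at p)"
    by (rule has_derivative_transform_within_open[OF _ U]) (rule t)
  note frechet_derivative_at[OF this]
  from fun_cong[OF this, of \<xi>]
  have "frechet_derivative (\<lambda>q. tangent z q \<eta>) (at p) \<xi>
     = fst \<eta> *\<^sub>R (fst \<xi> *\<^sub>R pd_u (pd_u z) p + snd \<xi> *\<^sub>R pd_v (pd_u z) p)
        + snd \<eta> *\<^sub>R (fst \<xi> *\<^sub>R pd_u (pd_v z) p + snd \<xi> *\<^sub>R pd_v (pd_v z) p)"
    by simp
  also have "\<dots> = (fst \<xi> * fst \<eta>) *\<^sub>R pd_u (pd_u z) p
      + (fst \<xi> * snd \<eta> + snd \<xi> * fst \<eta>) *\<^sub>R pd_v (pd_u z) p + (snd \<xi> * snd \<eta>) *\<^sub>R pd_v (pd_v z) p"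
    unfolding mixed_partials[OF U z]
    by (simp add: scaleR_add_right scaleR_add_left mult.commute)
  finally show ?thesis by (simp add: sff_def)
qed

text \<open>For a pseudo-orthogonal pair the difference of the two diagonal values of a bilinear form is
  its trace: the matrix \<open>\<xi> \<xi>\<^sup>T - \<eta> \<eta>\<^sup>T\<close> is a multiple of the inverse of the metric.\<close>

lemma pseudo_orthogonal_trace:
  fixes E F G t x1 x2 y1 y2 :: real
  assumes "E * x1\<^sup>2 + 2 * F * x1 * x2 + G * x2\<^sup>2 = t" "E * y1\<^sup>2 + 2 * F * y1 * y2 + G * y2\<^sup>2 = - t"
    "E * x1 * y1 + F * (x1 * y2 + x2 * y1) + G * x2 * y2 = 0" "t \<noteq> 0"
  shows "(x1\<^sup>2 - y1\<^sup>2) * (E * G - F\<^sup>2) = t * G"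
    "(x1 * x2 - y1 * y2) * (E * G - F\<^sup>2) = - t * F"
    "(x2\<^sup>2 - y2\<^sup>2) * (E * G - F\<^sup>2) = t * E"
proof -
  define d where "d = x1 * y2 - x2 * y1"
  have "d\<^sup>2 * (E * G - F\<^sup>2) = (E * x1\<^sup>2 + 2 * F * x1 * x2 + G * x2\<^sup>2)
      * (E * y1\<^sup>2 + 2 * F * y1 * y2 + G * y2\<^sup>2) - (E * x1 * y1 + F * (x1 * y2 + x2 * y1) + G * x2 * y2)\<^sup>2"
    unfolding d_def by algebra
  also have "\<dots> = - (t * t)" unfolding assms(1-3) by simp
  finally have d: "d \<noteq> 0" using assms(4) by auto
  \<comment> \<open>The entries of \<open>(\<xi> \<xi>\<^sup>T - \<eta> \<eta>\<^sup>T) g - t\<close>, a matrix that annihilates both \<open>\<xi>\<close> and \<open>\<eta>\<close>.\<close>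
  define n11 n12 n21 n22 where "n11 = (x1\<^sup>2 - y1\<^sup>2) * E + (x1 * x2 - y1 * y2) * F - t"
    and "n12 = (x1\<^sup>2 - y1\<^sup>2) * F + (x1 * x2 - y1 * y2) * G"
    and "n21 = (x1 * x2 - y1 * y2) * E + (x2\<^sup>2 - y2\<^sup>2) * F"
    and "n22 = (x1 * x2 - y1 * y2) * F + (x2\<^sup>2 - y2\<^sup>2) * G - t"
  note n = n11_def n12_def n21_def n22_def
  let ?x = "E * x1\<^sup>2 + 2 * F * x1 * x2 + G * x2\<^sup>2" and ?y = "E * y1\<^sup>2 + 2 * F * y1 * y2 + G * y2\<^sup>2"
    and ?xy = "E * x1 * y1 + F * (x1 * y2 + x2 * y1) + G * x2 * y2"
  have "n11 * x1 + n12 * x2 = x1 * ?x - y1 * ?xy - t * x1"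
    "n11 * y1 + n12 * y2 = x1 * ?xy - y1 * ?y - t * y1"
    "n21 * x1 + n22 * x2 = x2 * ?x - y2 * ?xy - t * x2"
    "n21 * y1 + n22 * y2 = x2 * ?xy - y2 * ?y - t * y2"
    unfolding n by algebra+
  then have "n11 * x1 + n12 * x2 = 0" "n11 * y1 + n12 * y2 = 0"
    "n21 * x1 + n22 * x2 = 0" "n21 * y1 + n22 * y2 = 0"
    unfolding assms(1-3) by simp_all
  then have "d * n11 = 0" "d * n12 = 0" "d * n21 = 0" "d * n22 = 0"
    unfolding d_def by algebra+
  then have "n11 = 0" "n12 = 0" "n21 = 0" "n22 = 0" using d by simp_all
  then show "(x1\<^sup>2 - y1\<^sup>2) * (E * G - F\<^sup>2) = t * G"
    "(x1 * x2 - y1 * y2) * (E * G - F\<^sup>2) = - t * F"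
    "(x2\<^sup>2 - y2\<^sup>2) * (E * G - F\<^sup>2) = t * E"
    unfolding n by algebra+
qed

text \<open>The description that defines the mean curvature vector singles out one vector, since all orthonormal
  pairs give the same value, a trace, and since the Gram-Schmidt process applied to \<open>z\<^sub>u, z\<^sub>v\<close> yields such
  a pair.\<close>

lemma mean_curvature_eq:
  assumes U: "open U" "p \<in> U" and z: "smooth_on_plane z U" and adm: "admissible_at z p"
  shows "mean_curvature z p = normal_part z p ((1 / (2 * gram z p)) *\<^sub>R
    (coeff_G z p *\<^sub>R pd_u (pd_u z) p - (2 * coeff_F z p) *\<^sub>R pd_v (pd_u z) p
      + coeff_E z p *\<^sub>R pd_v (pd_v z) p))"
    (is "_ = normal_part z p ?T")
proof -
  let ?E = "coeff_E z p" and ?F = "coeff_F z p" and ?G = "coeff_G z p" and ?Q = "gram z p"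
  have Q: "?Q < 0" by (rule gram_neg[OF adm])
  have tan: "nmetric (tangent z p \<xi>) (tangent z p \<eta>)
      = ?E * fst \<xi> * fst \<eta> + ?F * (fst \<xi> * snd \<eta> + snd \<xi> * fst \<eta>) + ?G * snd \<xi> * snd \<eta>" for \<xi> \<eta>
    unfolding tangent_def frechet_derivative_plane[OF smooth_on_planeD(1)[OF z U(2)]]
    by (simp add: nmetric_linear coeff_E_def coeff_F_def coeff_G_def
        nmetric_commute[of "pd_v z p" "pd_u z p"] algebra_simps)
  have val: "normal_part z p ?T = (1/2) *\<^sub>R (sff z p \<xi> \<xi> - sff z p \<eta> \<eta>)"
    if on: "orthonormal_tangents z p \<xi> \<eta>" for \<xi> \<eta>
  proof -
    have o: "?E * (fst \<xi>)\<^sup>2 + 2 * ?F * fst \<xi> * snd \<xi> + ?G * (snd \<xi>)\<^sup>2 = 1"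
      "?E * (fst \<eta>)\<^sup>2 + 2 * ?F * fst \<eta> * snd \<eta> + ?G * (snd \<eta>)\<^sup>2 = - 1"
      "?E * fst \<xi> * fst \<eta> + ?F * (fst \<xi> * snd \<eta> + snd \<xi> * fst \<eta>) + ?G * snd \<xi> * snd \<eta> = 0"
      using on by (simp_all add: orthonormal_tangents_def tan power2_eq_square algebra_simps)
    have "(fst \<xi> ^ 2 - fst \<eta> ^ 2) * ?Q = 1 * ?G"
      "(fst \<xi> * snd \<xi> - fst \<eta> * snd \<eta>) * ?Q = - 1 * ?F"
      "(snd \<xi> ^ 2 - snd \<eta> ^ 2) * ?Q = 1 * ?E"
      unfolding gram_def using pseudo_orthogonal_trace[OF o] by simp_all
    then have c: "?G / ?Q = fst \<xi> * fst \<xi> - fst \<eta> * fst \<eta>"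
      "- ?F / ?Q = fst \<xi> * snd \<xi> - fst \<eta> * snd \<eta>" "?E / ?Q = snd \<xi> * snd \<xi> - snd \<eta> * snd \<eta>"
      using Q by (simp_all add: divide_eq_eq power2_eq_square del: divide_minus_left)
    have "?T = (1/2) *\<^sub>R ((?G / ?Q) *\<^sub>R pd_u (pd_u z) p + (2 * (- ?F / ?Q)) *\<^sub>R pd_v (pd_u z) p
        + (?E / ?Q) *\<^sub>R pd_v (pd_v z) p)"
      by (simp add: scaleR_add_right scaleR_diff_right)
    also have "\<dots> = (1/2) *\<^sub>R
        (((fst \<xi> * fst \<xi>) *\<^sub>R pd_u (pd_u z) p + (fst \<xi> * snd \<xi> + snd \<xi> * fst \<xi>) *\<^sub>R pd_v (pd_u z) p
          + (snd \<xi> * snd \<xi>) *\<^sub>R pd_v (pd_v z) p)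
        - ((fst \<eta> * fst \<eta>) *\<^sub>R pd_u (pd_u z) p + (fst \<eta> * snd \<eta> + snd \<eta> * fst \<eta>) *\<^sub>R pd_v (pd_u z) p
          + (snd \<eta> * snd \<eta>) *\<^sub>R pd_v (pd_v z) p))"
      unfolding c by (simp add: algebra_simps)
    finally show ?thesis
      unfolding sff_eq[OF U z] normal_part_linear[OF adm, symmetric] by (rule arg_cong)
  qed
  have ex: "\<exists>\<xi> \<eta>. orthonormal_tangents z p \<xi> \<eta>"
  proof -
    have E: "?E > 0" using adm by (simp add: admissible_at_def)
    define s where "s = sqrt ?E"
    define r where "r = sqrt (- ?E * ?Q)"
    have s: "s > 0" "s * s = ?E" using E by (simp_all add: s_def)
    have EQ: "- ?E * ?Q > 0" using E Q by (simp add: mult_pos_neg)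
    then have r: "r > 0" "r * r = - ?E * ?Q"
      unfolding r_def by (simp_all only: real_sqrt_gt_zero real_sqrt_mult_self abs_of_pos)
    have "orthonormal_tangents z p (1 / s, 0) (- ?F / r, ?E / r)"
      using s r E Q unfolding orthonormal_tangents_def tan
      by (simp add: field_simps) (simp add: gram_def power2_eq_square algebra_simps)
    then show ?thesis by blast
  qed
  show ?thesis
    unfolding mean_curvature_def
  proof (rule the_equality)
    fix h assume "\<forall>\<xi> \<eta>. orthonormal_tangents z p \<xi> \<eta> \<longrightarrow> h = (1/2) *\<^sub>R (sff z p \<xi> \<xi> - sff z p \<eta> \<eta>)"
    then show "h = normal_part z p ?T" using ex val by fastforce
  qed (use val in blast)
qed

lemma nmetric_mean_curvature:
  assumes "open U" "p \<in> U" "smooth_on_plane z U" "admissible_at z p" "normal_at z p n"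
  shows "2 * gram z p * nmetric (mean_curvature z p) n
    = coeff_G z p * c11 z p n - 2 * coeff_F z p * c12 z p n + coeff_E z p * c22 z p n"
proof -
  have "gram z p \<noteq> 0" using gram_neg[OF assms(4)] by simp
  then show ?thesis
    unfolding mean_curvature_eq[OF assms(1-4)] nmetric_normal_part[OF assms(4,5)]
    by (simp add: nmetric_linear c11_def c12_def c22_def)
qed

section \<open>Recognising canonical parameters\<close>

text \<open>The normal plane is two-dimensional, so a unit normal orthogonal to \<open>b\<close> is determined up to sign,
  and the orientation condition selects one of the two signs.  Only the pair \<open>l, - l\<close> matters for the
  absolute value of \<open>\<mu>\<close>.\<close>

lemma frame_l_eq:
  assumes w: "w differentiable (at q)" and adm: "admissible_at w q"
    and s: "eps w q = s" "s = 1 \<or> s = - 1"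
    and b: "normal_at w q (frame_b w q)" "nmetric (frame_b w q) (frame_b w q) = s"
    and l: "normal_at w q l" "nmetric l l = - s" "nmetric (frame_b w q) l = 0"
  shows "frame_l w q = l \<or> frame_l w q = - l"
proof -
  let ?b = "frame_b w q"
  define x y where "x = tangent w q (comp_x w q)" and "y = tangent w q (comp_y w q)"
  define i j where "i = 1 / sqrt (coeff_E w q)" and "j = 1 / sqrt (- coeff_G w q)"
  have ij: "i \<noteq> 0" "j \<noteq> 0" using adm by (simp_all add: i_def j_def admissible_at_def)
  have xy: "x = i *\<^sub>R pd_u w q" "y = j *\<^sub>R pd_v w q"
    by (simp_all add: x_def y_def i_def j_def tangent_def comp_x_def comp_y_def
        frechet_derivative_plane[OF w])
  have s0: "s \<noteq> 0" using s by auto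
  have gram: "coeff_E w q * coeff_G w q - (coeff_F w q)\<^sup>2 \<noteq> 0"
    using gram_neg[OF adm] by (simp add: gram_def)
  have "nmetric x x * nmetric y y - (nmetric x y)\<^sup>2
      = (i * j)\<^sup>2 * (coeff_E w q * coeff_G w q - (coeff_F w q)\<^sup>2)"
    by (simp add: xy nmetric_linear coeff_E_def coeff_F_def coeff_G_def power2_eq_square algebra_simps)
  then have nd: "nmetric x x * nmetric y y - (nmetric x y)\<^sup>2 \<noteq> 0"
    using ij gram by simp
  have o: "nmetric ?b x = 0" "nmetric ?b y = 0" "nmetric l x = 0" "nmetric l y = 0"
    using b(1) l(1) by (simp_all add: xy normal_at_def nmetric_linear)
  interpret S1: split_frame x y ?b l
    using nd o b l s0 by unfold_locales simp_all
  interpret S2: split_frame x y l ?b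
    using nd o b l s0 by unfold_locales (simp_all add: nmetric_commute)
  define orient where "orient n = (if s = 1 then det (vector [x, y, ?b, n] :: real^4^4)
      else det (vector [x, y, n, ?b] :: real^4^4))" for n
  have om: "orient (- n) = - orient n" for n
    by (simp add: orient_def det_vector_4_minus)
  have on: "orient l \<noteq> 0"
    using S1.det_nonzero S2.det_nonzero by (simp add: orient_def)
  define l0 where "l0 = (if orient l > 0 then l else - l)"
  have l0: "orient l0 > 0" using on om by (simp add: l0_def)
  have "frame_l w q = (THE n. normal_at w q n \<and> nmetric n n = - s \<and> nmetric ?b n = 0 \<and> orient n > 0)"
    unfolding frame_l_def s(1) orient_def positively_oriented_def x_def y_def
    by (rule arg_cong[where f = The]) (auto simp: fun_eq_iff)
  also have "\<dots> = l0"
  proof (rule the_equality)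
    show "normal_at w q l0 \<and> nmetric l0 l0 = - s \<and> nmetric ?b l0 = 0 \<and> orient l0 > 0"
      using l l0 by (simp add: l0_def normal_at_def nmetric_linear)
  next
    fix n assume n: "normal_at w q n \<and> nmetric n n = - s \<and> nmetric ?b n = 0 \<and> orient n > 0"
    define k where "k = nmetric n l / nmetric l l"
    have "nmetric n x = 0" "nmetric n y = 0" "nmetric n ?b = 0"
      using n by (simp_all add: xy normal_at_def nmetric_linear nmetric_commute)
    then have nk: "n = k *\<^sub>R l" using S1.normal_expansion[of n] by (simp add: k_def)
    have "k * k * nmetric l l = nmetric n n" by (simp add: nk nmetric_linear)
    then have "k * k = 1" using n l(2) s0 by simp
    then have "k = 1 \<or> k = - 1" by (simp add: square_eq_1_iff)
    then have "n = l \<or> n = - l" using nk by auto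
    then show "n = l0" using n l0 om[of l] unfolding l0_def by auto
  qed
  finally show ?thesis unfolding l0_def by auto
qed

text \<open>A pointwise criterion.  If the form \<open>\<langle>\<sigma>, l\<rangle>\<close> equals \<open>2 du dv\<close> and the metric is \<open>(du\<^sup>2 - dv\<^sup>2) / m\<close>,
  then \<open>l\<close> is orthogonal to the mean curvature vector, which is therefore a nonzero multiple of \<open>b\<close>.
  Hence \<open>b\<close> and \<open>l\<close> agree up to sign with the geometric frame.  The parameters are principal because
  the diagonal coefficients of every normal vector are proportional to those of \<open>b\<close>, and
  \<open>\<mu> = \<plusminus> m \<langle>\<sigma>(z\<^sub>u, z\<^sub>v), l\<rangle> = \<plusminus> m\<close>.\<close>

lemma canonical_at:
  assumes V: "open V" "q \<in> V" and w: "smooth_on_plane w V"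
    and m: "m > 0" and EFG: "coeff_E w q = 1 / m" "coeff_F w q = 0" "coeff_G w q = - 1 / m"
    and b: "normal_at w q b" "\<bar>nmetric b b\<bar> = 1"
    and l: "normal_at w q l" "nmetric l l = - nmetric b b" "nmetric b l = 0"
    and cl: "c11 w q l = 0" "c12 w q l = 1" "c22 w q l = 0"
    and cb: "c11 w q b \<noteq> c22 w q b"
  shows "principal_at w q" "\<bar>mu w q\<bar> = m"
proof -
  define s where "s = nmetric b b"
  have s: "s = 1 \<or> s = - 1" using b(2) by (auto simp: s_def abs_if split: if_splits)
  have s0: "s \<noteq> 0" "s * s = 1" using s by auto
  have ls: "nmetric l l = - s" using l by (simp add: s_def)
  have adm: "admissible_at w q" using EFG m by (simp add: admissible_at_def)
  have gram: "gram w q \<noteq> 0" using gram_neg[OF adm] by simp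
  interpret split_frame "pd_u w q" "pd_v w q" b l
    using gram b l s0 ls
    by unfold_locales
      (simp_all add: gram_def coeff_E_def coeff_F_def coeff_G_def normal_at_def s_def)
  have exp: "n = (nmetric n b / s) *\<^sub>R b + (nmetric n l / - s) *\<^sub>R l" if "normal_at w q n" for n
    using normal_expansion[of n] that ls by (simp add: normal_at_def s_def)
  show "principal_at w q"
    unfolding principal_at_def
  proof (intro conjI allI impI adm EFG(2))
    fix n1 n2 assume nf: "normal_frame w q n1 n2"
    have c: "c11 w q n = (nmetric n b / s) * c11 w q b" "c22 w q n = (nmetric n b / s) * c22 w q b"
      if "normal_at w q n" for n
    proof -
      have "c11 w q n = (nmetric n b / s) * c11 w q b + (nmetric n l / - s) * c11 w q l"
        "c22 w q n = (nmetric n b / s) * c22 w q b + (nmetric n l / - s) * c22 w q l"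
        unfolding c11_def c22_def
        by (subst (1) exp[OF that], simp only: nmetric_linear real_scaleR_def)+
      then show "c11 w q n = (nmetric n b / s) * c11 w q b" "c22 w q n = (nmetric n b / s) * c22 w q b"
        using cl by simp_all
    qed
    have n12: "normal_at w q n1" "normal_at w q n2" using nf by (simp_all add: normal_frame_def)
    show "coeff_M w q n1 n2 = 0"
      unfolding coeff_M_def Delta2_def c[OF n12(1)] c[OF n12(2)] by simp
  qed
  let ?H = "mean_curvature w q"
  have nH: "normal_at w q ?H"
    unfolding mean_curvature_eq[OF V w adm] by (rule normal_part_normal(1)[OF adm])
  have "nmetric ?H l = 0"
    using nmetric_mean_curvature[OF V w adm l(1)] gram by (simp add: cl EFG)
  moreover have Hb: "nmetric ?H b \<noteq> 0"
    using nmetric_mean_curvature[OF V w adm b(1)] gram cb m by (auto simp: EFG field_simps)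
  moreover define c where "c = nmetric ?H b / s"
  ultimately have H: "?H = c *\<^sub>R b" and c0: "c \<noteq> 0" using exp[OF nH] s0 by (simp_all add: c_def)
  have HH: "nmetric ?H ?H = c * c * s" by (simp add: H nmetric_linear s_def)
  have eps: "eps w q = s"
    unfolding eps_def HH using s c0 by (auto simp: sgn_mult)
  have "frame_b w q = (s / sqrt (s * (c * c * s))) *\<^sub>R c *\<^sub>R b"
    unfolding frame_b_def eps HH by (simp add: H)
  also have "s * (c * c * s) = c * c" using s by auto
  finally have fb: "frame_b w q = (s * c / \<bar>c\<bar>) *\<^sub>R b" by simp
  define k where "k = s * c / \<bar>c\<bar>"
  have k: "k * k = 1" using s c0 by (auto simp: k_def)
  have l': "frame_l w q = l \<or> frame_l w q = - l"
  proof (rule frame_l_eq[OF smooth_on_planeD(1)[OF w V(2)] adm eps s])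
    show "normal_at w q (frame_b w q)" using b(1) unfolding fb by (simp add: normal_at_def nmetric_linear)
    show "nmetric (frame_b w q) (frame_b w q) = s"
      using k unfolding fb k_def[symmetric] by (simp add: nmetric_linear s_def flip: mult.assoc)
    show "nmetric (frame_b w q) l = 0" unfolding fb using l by (simp add: nmetric_linear)
  qed (use l ls in simp_all)
  have "nmetric (sff w q (comp_x w q) (comp_y w q)) l = m"
    unfolding sff_eq[OF V w] nmetric_normal_part[OF adm l(1)]
    using cl(2) m by (simp add: comp_x_def comp_y_def EFG nmetric_linear c12_def real_sqrt_divide)
  then show "\<bar>mu w q\<bar> = m"
    using l' m by (auto simp: mu_def nmetric_linear)
qed

section \<open>Closedness of the principal coframe\<close>

lemma pd_lincomb:
  fixes f g :: "real \<times> real \<Rightarrow> real"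
  assumes "f differentiable (at p)" "g differentiable (at p)" "x differentiable (at p)" "y differentiable (at p)"
  shows "pd_u (\<lambda>q. f q *\<^sub>R x q + g q *\<^sub>R y q) p
      = f p *\<^sub>R pd_u x p + pd_u f p *\<^sub>R x p + (g p *\<^sub>R pd_u y p + pd_u g p *\<^sub>R y p)"
    "pd_v (\<lambda>q. f q *\<^sub>R x q + g q *\<^sub>R y q) p
      = f p *\<^sub>R pd_v x p + pd_v f p *\<^sub>R x p + (g p *\<^sub>R pd_v y p + pd_v g p *\<^sub>R y p)"
proof -
  note d = has_derivative_add[OF has_derivative_plane_bilinear[OF bounded_bilinear_scaleR assms(1,3)]
      has_derivative_plane_bilinear[OF bounded_bilinear_scaleR assms(2,4)]]
  show "pd_u (\<lambda>q. f q *\<^sub>R x q + g q *\<^sub>R y q) p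
      = f p *\<^sub>R pd_u x p + pd_u f p *\<^sub>R x p + (g p *\<^sub>R pd_u y p + pd_u g p *\<^sub>R y p)"
    using pd_eqI(1)[OF d] by simp
  show "pd_v (\<lambda>q. f q *\<^sub>R x q + g q *\<^sub>R y q) p
      = f p *\<^sub>R pd_v x p + pd_v f p *\<^sub>R x p + (g p *\<^sub>R pd_v y p + pd_v g p *\<^sub>R y p)"
    using pd_eqI(2)[OF d] by simp
qed

lemma pd_const: "pd_u (\<lambda>_. c) p = 0" "pd_v (\<lambda>_. c) p = 0"
  using pd_eqI[OF has_derivative_const[of c "at p"]] by simp_all

lemma pd_nmetric_const:
  assumes "open U" "p \<in> U" "\<And>q. q \<in> U \<Longrightarrow> nmetric (f q) (g q) = c"
    and d: "f differentiable (at p)" "g differentiable (at p)"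
  shows "nmetric (pd_u f p) (g p) = - nmetric (f p) (pd_u g p)"
    "nmetric (pd_v f p) (g p) = - nmetric (f p) (pd_v g p)"
proof -
  note n = pd_bilinear[OF nmetric.bounded_bilinear_axioms d]
  have "pd_u (\<lambda>q. nmetric (f q) (g q)) p = 0" "pd_v (\<lambda>q. nmetric (f q) (g q)) p = 0"
    using differentiable_plane_cong(2,3)[OF assms(1,2,3) n(3)] by (simp_all add: pd_const)
  then show "nmetric (pd_u f p) (g p) = - nmetric (f p) (pd_u g p)"
    "nmetric (pd_v f p) (g p) = - nmetric (f p) (pd_v g p)"
    using n by simp_all
qed

text \<open>The heart of the proof, a form of the Codazzi equations.  Write \<open>dz = x p + y q\<close> with null vectors \<open>x, y\<close>
  and one-forms \<open>p = p1 du + p2 dv\<close>, \<open>q = q1 du + q2 dv\<close>.  If the second fundamental form in the direction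
  of a parallel normal \<open>l\<close> has no mixed term \<open>p q\<close> and is normalized to \<open>(p\<^sup>2 - q\<^sup>2) / 2\<close>, then
  \<open>dl = m (x q - y p)\<close>, where \<open>2 m \<langle>x, y\<rangle> = 1\<close>.  Taking exterior derivatives, the product of \<open>d(dz) = 0\<close>
  with \<open>y\<close> and of \<open>d(dl) = 0\<close> with \<open>x\<close> both express \<open>dp\<close> through the connection forms
  \<open>\<langle>dx, y\<rangle>\<close> and \<open>\<langle>dy, x\<rangle>\<close>.  These forms add up to \<open>d\<langle>x, y\<rangle> = - \<langle>x, y\<rangle> dm / m\<close>, and with
  this relation they cancel, so that \<open>dp = 0\<close>.  The argument for \<open>q\<close> is symmetric.\<close>

lemma null_coframe_closed:
  fixes x y :: "real \<times> real \<Rightarrow> real^4" and p1 p2 q1 q2 m :: "real \<times> real \<Rightarrow> real"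
  assumes U: "open U" "p \<in> U" and zl: "smooth_on_plane z U" "smooth_on_plane l U"
    and xy: "smooth_on_plane x U" "smooth_on_plane y U"
    and sc: "smooth_on_plane p1 U" "smooth_on_plane p2 U" "smooth_on_plane q1 U" "smooth_on_plane q2 U"
      "smooth_on_plane m U"
    and null: "\<And>q. q \<in> U \<Longrightarrow> nmetric (x q) (x q) = 0" "\<And>q. q \<in> U \<Longrightarrow> nmetric (y q) (y q) = 0"
      "\<And>q. q \<in> U \<Longrightarrow> 2 * m q * nmetric (x q) (y q) = 1"
    and dz: "\<And>q. q \<in> U \<Longrightarrow> pd_u z q = p1 q *\<^sub>R x q + q1 q *\<^sub>R y q"
      "\<And>q. q \<in> U \<Longrightarrow> pd_v z q = p2 q *\<^sub>R x q + q2 q *\<^sub>R y q"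
    and dl: "\<And>q. q \<in> U \<Longrightarrow> pd_u l q = (m q * q1 q) *\<^sub>R x q + (- (m q * p1 q)) *\<^sub>R y q"
      "\<And>q. q \<in> U \<Longrightarrow> pd_v l q = (m q * q2 q) *\<^sub>R x q + (- (m q * p2 q)) *\<^sub>R y q"
  shows "pd_v p1 p = pd_u p2 p" "pd_v q1 p = pd_u q2 p"
proof -
  note dx = smooth_on_planeD(1)[OF xy(1) U(2)] and dy = smooth_on_planeD(1)[OF xy(2) U(2)]
  note ds = smooth_on_planeD(1)[OF sc(1) U(2)] smooth_on_planeD(1)[OF sc(2) U(2)]
    smooth_on_planeD(1)[OF sc(3) U(2)] smooth_on_planeD(1)[OF sc(4) U(2)]
    smooth_on_planeD(1)[OF sc(5) U(2)]
  note d2 = smooth_on_planeD(1)[OF smooth_on_planeD(2)[OF zl(1)] U(2)]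
    smooth_on_planeD(1)[OF smooth_on_planeD(3)[OF zl(1)] U(2)]
    smooth_on_planeD(1)[OF smooth_on_planeD(2)[OF zl(2)] U(2)]
    smooth_on_planeD(1)[OF smooth_on_planeD(3)[OF zl(2)] U(2)]
  have s4: "smooth_on_plane (\<lambda>q. m q * q1 q) U" "smooth_on_plane (\<lambda>q. m q * q2 q) U"
    "smooth_on_plane (\<lambda>q. - (m q * p1 q)) U" "smooth_on_plane (\<lambda>q. - (m q * p2 q)) U"
    by (rule smooth_minus smooth_mult U sc)+
  note dm = smooth_on_planeD(1)[OF s4(1) U(2)] smooth_on_planeD(1)[OF s4(2) U(2)]
    smooth_on_planeD(1)[OF s4(3) U(2)] smooth_on_planeD(1)[OF s4(4) U(2)]
  have pm: "pd_u (\<lambda>q. m q * q2 q) p = m p * pd_u q2 p + pd_u m p * q2 p"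
    "pd_v (\<lambda>q. m q * q1 q) p = m p * pd_v q1 p + pd_v m p * q1 p"
    "pd_u (\<lambda>q. - (m q * p2 q)) p = - (m p * pd_u p2 p + pd_u m p * p2 p)"
    "pd_v (\<lambda>q. - (m q * p1 q)) p = - (m p * pd_v p1 p + pd_v m p * p1 p)"
    using pd_bilinear[OF bounded_bilinear_mult ds(5,4)] pd_bilinear[OF bounded_bilinear_mult ds(5,3)]
      pd_bilinear[OF bounded_bilinear_mult ds(5,2)] pd_bilinear[OF bounded_bilinear_mult ds(5,1)]
      pd_bounded_linear[OF bounded_linear_minus[OF bounded_linear_ident], of "\<lambda>q. m q * p2 q"]
      pd_bounded_linear[OF bounded_linear_minus[OF bounded_linear_ident], of "\<lambda>q. m q * p1 q"]
    by simp_all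
  \<comment> \<open>The integrability condition \<open>z\<^sub>u\<^sub>v = z\<^sub>v\<^sub>u\<close> in the null frame.\<close>
  have Z: "p1 p *\<^sub>R pd_v x p + pd_v p1 p *\<^sub>R x p + (q1 p *\<^sub>R pd_v y p + pd_v q1 p *\<^sub>R y p)
      = p2 p *\<^sub>R pd_u x p + pd_u p2 p *\<^sub>R x p + (q2 p *\<^sub>R pd_u y p + pd_u q2 p *\<^sub>R y p)"
    using mixed_partials[OF U zl(1)]
      differentiable_plane_cong(3)[OF U dz(1) d2(1)] differentiable_plane_cong(2)[OF U dz(2) d2(2)]
      pd_lincomb(2)[OF ds(1,3) dx dy] pd_lincomb(1)[OF ds(2,4) dx dy] by simp
  have L: "(m p * q1 p) *\<^sub>R pd_v x p + (m p * pd_v q1 p + pd_v m p * q1 p) *\<^sub>R x p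
      + (- (m p * p1 p) *\<^sub>R pd_v y p + (- (m p * pd_v p1 p + pd_v m p * p1 p)) *\<^sub>R y p)
      = (m p * q2 p) *\<^sub>R pd_u x p + (m p * pd_u q2 p + pd_u m p * q2 p) *\<^sub>R x p
      + (- (m p * p2 p) *\<^sub>R pd_u y p + (- (m p * pd_u p2 p + pd_u m p * p2 p)) *\<^sub>R y p)"
    using mixed_partials[OF U zl(2)]
      differentiable_plane_cong(3)[OF U dl(1) d2(3)] differentiable_plane_cong(2)[OF U dl(2) d2(4)]
      pd_lincomb(2)[OF dm(1,3) dx dy] pd_lincomb(1)[OF dm(2,4) dx dy] pm by simp
  define k where "k = nmetric (x p) (y p)"
  define au av cu cv where "au = nmetric (pd_u x p) (y p)" and "av = nmetric (pd_v x p) (y p)"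
    and "cu = nmetric (pd_u y p) (x p)" and "cv = nmetric (pd_v y p) (x p)"
  have n: "nmetric (x p) (x p) = 0" "nmetric (y p) (y p) = 0" using null U by simp_all
  have nd: "nmetric (pd_u x p) (x p) = 0" "nmetric (pd_v x p) (x p) = 0"
    "nmetric (pd_u y p) (y p) = 0" "nmetric (pd_v y p) (y p) = 0"
    using pd_nmetric_const[OF U null(1) dx dx] pd_nmetric_const[OF U null(2) dy dy]
    by (simp_all add: nmetric_commute)
  have yx: "nmetric (y p) (x p) = k" by (simp add: k_def nmetric_commute)
  \<comment> \<open>Both integrability conditions, paired with the two null vectors.\<close>
  have Zx: "q1 p * cv + pd_v q1 p * k = q2 p * cu + pd_u q2 p * k"
    using arg_cong[OF Z, of "\<lambda>v. nmetric v (x p)"] by (simp add: nmetric_linear n nd yx cu_def cv_def)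
  have Zy: "p1 p * av + pd_v p1 p * k = p2 p * au + pd_u p2 p * k"
    using arg_cong[OF Z, of "\<lambda>v. nmetric v (y p)"]
    by (simp add: nmetric_linear n nd au_def av_def flip: k_def)
  have Lx: "m p * p1 p * cv + (m p * pd_v p1 p + pd_v m p * p1 p) * k
      = m p * p2 p * cu + (m p * pd_u p2 p + pd_u m p * p2 p) * k"
    using arg_cong[OF L, of "\<lambda>v. nmetric v (x p)"]
    by (simp add: nmetric_linear n nd yx flip: cu_def cv_def) (simp add: algebra_simps)
  have Ly: "m p * q1 p * av + (m p * pd_v q1 p + pd_v m p * q1 p) * k
      = m p * q2 p * au + (m p * pd_u q2 p + pd_u m p * q2 p) * k"
    using arg_cong[OF L, of "\<lambda>v. nmetric v (y p)"]
    by (simp add: nmetric_linear n nd au_def av_def flip: k_def)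
  have mk: "2 * m p * k = 1" using null(3)[OF U(2)] by (simp add: k_def)
  have dxy: "(\<lambda>q. nmetric (x q) (y q)) differentiable (at p)"
    "pd_u (\<lambda>q. nmetric (x q) (y q)) p = cu + au" "pd_v (\<lambda>q. nmetric (x q) (y q)) p = cv + av"
    using pd_bilinear[OF nmetric.bounded_bilinear_axioms dx dy]
    by (simp_all add: cu_def cv_def au_def av_def nmetric_commute)
  note dmk = pd_bilinear[OF bounded_bilinear_mult ds(5) dxy(1)]
  have half: "m q * nmetric (x q) (y q) = 1 / 2" if "q \<in> U" for q using null(3)[OF that] by simp
  have k': "m p * (cu + au) + pd_u m p * k = 0" "m p * (cv + av) + pd_v m p * k = 0"
    using differentiable_plane_cong(2,3)[OF U half dmk(3)] dmk(1,2) dxy(2,3)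
    by (simp_all add: pd_const k_def)
  have "pd_v p1 p - pd_u p2 p = 2 * m p * k * (pd_v p1 p - pd_u p2 p)" using mk by simp
  also have "\<dots> = 0" using Zy Lx k' by algebra
  finally show "pd_v p1 p = pd_u p2 p" by simp
  have "pd_v q1 p - pd_u q2 p = 2 * m p * k * (pd_v q1 p - pd_u q2 p)" using mk by simp
  also have "\<dots> = 0" using Zx Ly k' by algebra
  finally show "pd_v q1 p = pd_u q2 p" by simp
qed

section \<open>Canonical parameters from a traceless parallel normal field\<close>

lemma smooth_first_form:
  assumes D: "open D" and z: "smooth_on_plane z D"
  shows "smooth_on_plane (coeff_E z) D" "smooth_on_plane (coeff_F z) D" "smooth_on_plane (coeff_G z) D"
proof -
  have "smooth_on_plane (\<lambda>p. coeff_E z p) D" "smooth_on_plane (\<lambda>p. coeff_F z p) D"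
    "smooth_on_plane (\<lambda>p. coeff_G z p) D"
    unfolding coeff_E_def coeff_F_def coeff_G_def
    by (rule smooth_bilinear[OF D nmetric.bounded_bilinear_axioms] smooth_on_planeD(2,3)[OF z])+
  then show "smooth_on_plane (coeff_E z) D" "smooth_on_plane (coeff_F z) D" "smooth_on_plane (coeff_G z) D"
    by simp_all
qed

lemma coeff_W_pos:
  assumes "admissible_at z p"
  shows "coeff_W z p > 0" "coeff_W z p * coeff_W z p = (coeff_F z p)\<^sup>2 - coeff_E z p * coeff_G z p"
  using gram_neg[OF assms] by (simp_all add: coeff_W_def gram_def)

lemma smooth_coeff_W:
  assumes D: "open D" and z: "smooth_on_plane z D" and adm: "\<And>p. p \<in> D \<Longrightarrow> admissible_at z p"
  shows "smooth_on_plane (coeff_W z) D"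
proof -
  let ?r = "\<lambda>p. (coeff_F z p)\<^sup>2 - coeff_E z p * coeff_G z p"
  have r: "smooth_on_plane ?r D"
    by (rule smooth_diff smooth_mult smooth_power2 D smooth_first_form[OF D z])+
  have pos: "?r p > 0" if "p \<in> D" for p
    using gram_neg[OF adm[OF that]] by (simp add: gram_def)
  have eq: "sqrt (?r p) = coeff_W z p" if "p \<in> D" for p
    using pos[OF that] by (simp add: coeff_W_def abs_minus_commute)
  show ?thesis by (rule smooth_on_plane_cong[OF D eq smooth_sqrt[OF D pos r]])
qed

lemma smooth_second_form:
  assumes D: "open D" and z: "smooth_on_plane z D" and n: "smooth_on_plane n D"
  shows "smooth_on_plane (\<lambda>p. c11 z p (n p)) D" "smooth_on_plane (\<lambda>p. c12 z p (n p)) D"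
  unfolding c11_def c12_def
  by (rule smooth_bilinear[OF D nmetric.bounded_bilinear_axioms] n
      smooth_on_planeD(2,3)[OF smooth_on_planeD(2)[OF z]])+

text \<open>A surface with a parallel orthonormal normal frame \<open>b, l\<close> such that the trace of the second fundamental
  form vanishes in the direction of \<open>l\<close> but not in the direction of \<open>b\<close>.  The last condition says that the
  form in the direction of \<open>l\<close> takes values of opposite signs on the two null directions; the sign of
  \<open>l\<close> is normalized by leaving out an absolute value on the right.\<close>

locale traceless_normal =
  fixes D :: "(real \<times> real) set" and z b l :: "real \<times> real \<Rightarrow> real^4"
  assumes D: "open D"
    and smooth: "smooth_on_plane z D" "smooth_on_plane b D" "smooth_on_plane l D"
    and adm: "p \<in> D \<Longrightarrow> admissible_at z p"
    and normal: "p \<in> D \<Longrightarrow> normal_at z p (b p)" "p \<in> D \<Longrightarrow> normal_at z p (l p)"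
    and unit: "p \<in> D \<Longrightarrow> \<bar>nmetric (b p) (b p)\<bar> = 1" "p \<in> D \<Longrightarrow> nmetric (l p) (l p) = - nmetric (b p) (b p)"
      "p \<in> D \<Longrightarrow> nmetric (b p) (l p) = 0"
    and parallel: "p \<in> D \<Longrightarrow> nmetric (pd_u b p) (l p) = 0" "p \<in> D \<Longrightarrow> nmetric (pd_v b p) (l p) = 0"
    and traceless: "p \<in> D \<Longrightarrow> coeff_G z p * c11 z p (l p) - 2 * coeff_F z p * c12 z p (l p)
      + coeff_E z p * c22 z p (l p) = 0"
    and trace: "p \<in> D \<Longrightarrow> coeff_G z p * c11 z p (b p) - 2 * coeff_F z p * c12 z p (b p)
      + coeff_E z p * c22 z p (b p) \<noteq> 0"
    and indefinite: "p \<in> D \<Longrightarrow> \<bar>coeff_W z p * c11 z p (l p)\<bar>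
      < coeff_E z p * c12 z p (l p) - coeff_F z p * c11 z p (l p)"
begin

abbreviation "E \<equiv> coeff_E z"
abbreviation "F \<equiv> coeff_F z"
abbreviation "G \<equiv> coeff_G z"
abbreviation "W \<equiv> coeff_W z"

definition e where "e p = c11 z p (l p)"
definition f where "f p = c12 z p (l p)"
definition g where "g p = c22 z p (l p)"

text \<open>The metric factors as \<open>(E du + (F + W) dv) (E du + (F - W) dv) / E\<close>.  The form with coefficients
  \<open>e, f, g\<close> is traceless, hence a combination of the squares of the two factors.  The multiples
  \<open>p = rho du + p2 dv\<close> and \<open>q = kap du + q2 dv\<close> of the factors are chosen such that this combination becomes
  \<open>(p\<^sup>2 - q\<^sup>2) / 2\<close>, while the metric is \<open>p q / m\<close>.  The null vectors \<open>x, y\<close> form the basis dual to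
  \<open>p, q\<close>.\<close>

definition rho where "rho p = sqrt ((E p * f p - F p * e p + W p * e p) / W p)"
definition kap where "kap p = sqrt ((E p * f p - F p * e p - W p * e p) / W p)"
definition m where "m p = rho p * kap p / E p"

definition x where "x p = (1 / (2 * W p * rho p)) *\<^sub>R (E p *\<^sub>R pd_v z p - (F p - W p) *\<^sub>R pd_u z p)"
definition y where "y p = (1 / (2 * W p * kap p)) *\<^sub>R ((F p + W p) *\<^sub>R pd_u z p - E p *\<^sub>R pd_v z p)"

definition p2 where "p2 p = rho p * (F p + W p) / E p"
definition q2 where "q2 p = kap p * (F p - W p) / E p"

lemma EW:
  assumes "p \<in> D"
  shows "E p > 0" "W p > 0" "W p * W p = (F p)\<^sup>2 - E p * G p"
  using coeff_W_pos[OF adm[OF assms]] adm[OF assms] by (simp_all add: admissible_at_def)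

lemma rho_kap:
  assumes "p \<in> D"
  shows "(E p * f p - F p * e p + W p * e p) / W p > 0" "(E p * f p - F p * e p - W p * e p) / W p > 0"
    "rho p > 0" "kap p > 0" "m p > 0"
    "(kap p)\<^sup>2 - (rho p)\<^sup>2 = - 2 * e p" "W p * ((kap p)\<^sup>2 + (rho p)\<^sup>2) = 2 * (E p * f p - F p * e p)"
proof -
  note EW = EW[OF assms]
  show a: "(E p * f p - F p * e p + W p * e p) / W p > 0"
    and c: "(E p * f p - F p * e p - W p * e p) / W p > 0"
    using indefinite[OF assms] EW by (auto simp: e_def f_def)
  show r: "rho p > 0" and k: "kap p > 0" using a c by (simp_all only: rho_def kap_def real_sqrt_gt_zero)
  show "m p > 0" using r k EW by (simp add: m_def)
  have sq: "(rho p)\<^sup>2 = (E p * f p - F p * e p + W p * e p) / W p"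
    "(kap p)\<^sup>2 = (E p * f p - F p * e p - W p * e p) / W p"
    using a c by (simp_all only: rho_def kap_def real_sqrt_pow2 less_imp_le)
  show "(kap p)\<^sup>2 - (rho p)\<^sup>2 = - 2 * e p" "W p * ((kap p)\<^sup>2 + (rho p)\<^sup>2) = 2 * (E p * f p - F p * e p)"
    using EW unfolding sq by (simp_all add: field_simps)
qed

lemma smooth_coefficients:
  "smooth_on_plane E D" "smooth_on_plane F D" "smooth_on_plane G D" "smooth_on_plane W D"
  "smooth_on_plane e D" "smooth_on_plane f D"
  using smooth_first_form[OF D smooth(1)] smooth_coeff_W[OF D smooth(1) adm]
    smooth_second_form[OF D smooth(1,3)]
  unfolding e_def[abs_def] f_def[abs_def] by simp_all

lemma smooth_coframe:
  "smooth_on_plane rho D" "smooth_on_plane kap D" "smooth_on_plane m D"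
  "smooth_on_plane p2 D" "smooth_on_plane q2 D" "smooth_on_plane x D" "smooth_on_plane y D"
proof -
  note s = smooth_coefficients smooth_on_planeD(2,3)[OF smooth(1)]
  have nz: "E p \<noteq> 0" "W p \<noteq> 0" "2 * W p * rho p \<noteq> 0" "2 * W p * kap p \<noteq> 0" if "p \<in> D" for p
    using EW[OF that] rho_kap[OF that] by simp_all
  have "smooth_on_plane (\<lambda>p. sqrt ((E p * f p - F p * e p + W p * e p) / W p)) D"
    "smooth_on_plane (\<lambda>p. sqrt ((E p * f p - F p * e p - W p * e p) / W p)) D"
    by (rule smooth_sqrt smooth_divide smooth_add smooth_diff smooth_mult D s |
        (erule nz rho_kap))+
  then show r: "smooth_on_plane rho D" "smooth_on_plane kap D"
    unfolding rho_def[abs_def] kap_def[abs_def] by simp_all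
  have "smooth_on_plane (\<lambda>p. rho p * kap p / E p) D"
    "smooth_on_plane (\<lambda>p. rho p * (F p + W p) / E p) D" "smooth_on_plane (\<lambda>p. kap p * (F p - W p) / E p) D"
    by (rule smooth_divide smooth_add smooth_diff smooth_mult D s r | (erule nz))+
  then show "smooth_on_plane m D" "smooth_on_plane p2 D" "smooth_on_plane q2 D"
    unfolding m_def[abs_def] p2_def[abs_def] q2_def[abs_def] by simp_all
  have "smooth_on_plane (\<lambda>p. (1 / (2 * W p * rho p)) *\<^sub>R (E p *\<^sub>R pd_v z p - (F p - W p) *\<^sub>R pd_u z p)) D"
    "smooth_on_plane (\<lambda>p. (1 / (2 * W p * kap p)) *\<^sub>R ((F p + W p) *\<^sub>R pd_u z p - E p *\<^sub>R pd_v z p)) D"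
    by (rule smooth_scaleR smooth_divide smooth_const smooth_add smooth_diff smooth_mult D s r |
        (erule nz))+
  then show "smooth_on_plane x D" "smooth_on_plane y D"
    unfolding x_def[abs_def] y_def[abs_def] by simp_all
qed

lemma null_pairings:
  assumes p: "p \<in> D"
  shows "nmetric (x p) (x p) = 0" "nmetric (y p) (y p) = 0" "2 * m p * nmetric (x p) (y p) = 1"
    "nmetric (x p) (pd_u z p) = E p / (2 * rho p)" "nmetric (x p) (pd_v z p) = (F p - W p) / (2 * rho p)"
    "nmetric (y p) (pd_u z p) = E p / (2 * kap p)" "nmetric (y p) (pd_v z p) = (F p + W p) / (2 * kap p)"
proof -
  note EW = EW[OF p] and rk = rho_kap[OF p]
  define xv yv where "xv = E p *\<^sub>R pd_v z p - (F p - W p) *\<^sub>R pd_u z p"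
    and "yv = (F p + W p) *\<^sub>R pd_u z p - E p *\<^sub>R pd_v z p"
  have g: "nmetric (pd_u z p) (pd_u z p) = E p" "nmetric (pd_u z p) (pd_v z p) = F p"
    "nmetric (pd_v z p) (pd_u z p) = F p" "nmetric (pd_v z p) (pd_v z p) = G p"
    by (simp_all add: coeff_E_def coeff_F_def coeff_G_def nmetric_commute)
  have u: "nmetric xv (pd_u z p) = W p * E p" "nmetric yv (pd_u z p) = W p * E p"
    by (simp_all add: xv_def yv_def nmetric_linear g algebra_simps)
  have "nmetric xv (pd_v z p) = E p * G p - (F p - W p) * F p"
    "nmetric yv (pd_v z p) = (F p + W p) * F p - E p * G p"
    by (simp_all add: xv_def yv_def nmetric_linear g)
  then have v: "nmetric xv (pd_v z p) = W p * (F p - W p)" "nmetric yv (pd_v z p) = W p * (F p + W p)"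
    using EW(3) by algebra+
  have expand: "nmetric n xv = E p * nmetric n (pd_v z p) - (F p - W p) * nmetric n (pd_u z p)"
    "nmetric n yv = (F p + W p) * nmetric n (pd_u z p) - E p * nmetric n (pd_v z p)" for n
    by (simp_all add: xv_def yv_def nmetric_linear)
  have xy: "nmetric xv xv = 0" "nmetric yv yv = 0" "nmetric xv yv = 2 * W p * W p * E p"
    using expand[of xv] expand[of yv] by (simp_all add: u v algebra_simps nmetric_commute)
  have x: "x p = (1 / (2 * W p * rho p)) *\<^sub>R xv" and y: "y p = (1 / (2 * W p * kap p)) *\<^sub>R yv"
    by (simp_all add: x_def y_def xv_def yv_def)
  show "nmetric (x p) (x p) = 0" "nmetric (y p) (y p) = 0"
    by (simp_all add: x y nmetric_linear xy)
  show "2 * m p * nmetric (x p) (y p) = 1"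
    using EW rk by (simp add: x y nmetric_linear xy m_def)
  show "nmetric (x p) (pd_u z p) = E p / (2 * rho p)" "nmetric (x p) (pd_v z p) = (F p - W p) / (2 * rho p)"
    "nmetric (y p) (pd_u z p) = E p / (2 * kap p)" "nmetric (y p) (pd_v z p) = (F p + W p) / (2 * kap p)"
    using EW rk by (simp_all add: x y nmetric_linear u v)
qed

lemma null_decomposition:
  assumes p: "p \<in> D"
  shows "pd_u z p = rho p *\<^sub>R x p + kap p *\<^sub>R y p" "pd_v z p = p2 p *\<^sub>R x p + q2 p *\<^sub>R y p"
proof -
  note EW = EW[OF p] and rk = rho_kap[OF p]
  have c: "rho p * (1 / (2 * W p * rho p)) = 1 / (2 * W p)" "kap p * (1 / (2 * W p * kap p)) = 1 / (2 * W p)"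
    "p2 p * (1 / (2 * W p * rho p)) = 1 / (2 * W p * E p) * (F p + W p)"
    "q2 p * (1 / (2 * W p * kap p)) = 1 / (2 * W p * E p) * (F p - W p)"
    using EW rk by (simp_all add: p2_def q2_def field_simps)
  have "rho p *\<^sub>R x p + kap p *\<^sub>R y p = (1 / (2 * W p)) *\<^sub>R
      ((E p *\<^sub>R pd_v z p - (F p - W p) *\<^sub>R pd_u z p) + ((F p + W p) *\<^sub>R pd_u z p - E p *\<^sub>R pd_v z p))"
    unfolding x_def y_def scaleR_scaleR c by (simp only: scaleR_add_right)
  also have "\<dots> = (1 / (2 * W p)) *\<^sub>R (2 * W p) *\<^sub>R pd_u z p"
    by (rule arg_cong[of _ _ "scaleR _"]) (simp add: vec_eq_iff algebra_simps)
  finally show "pd_u z p = rho p *\<^sub>R x p + kap p *\<^sub>R y p" using EW by simp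
  have "p2 p *\<^sub>R x p + q2 p *\<^sub>R y p = (1 / (2 * W p * E p)) *\<^sub>R
      ((F p + W p) *\<^sub>R (E p *\<^sub>R pd_v z p - (F p - W p) *\<^sub>R pd_u z p)
        + (F p - W p) *\<^sub>R ((F p + W p) *\<^sub>R pd_u z p - E p *\<^sub>R pd_v z p))"
    unfolding x_def y_def scaleR_scaleR c by (simp only: scaleR_add_right scaleR_scaleR)
  also have "\<dots> = (1 / (2 * W p * E p)) *\<^sub>R (2 * W p * E p) *\<^sub>R pd_v z p"
    by (rule arg_cong[of _ _ "scaleR _"]) (simp add: vec_eq_iff algebra_simps)
  finally show "pd_v z p = p2 p *\<^sub>R x p + q2 p *\<^sub>R y p" using EW by simp
qed

text \<open>The Weingarten formula for \<open>l\<close>.  Since \<open>l\<close> is parallel, its derivatives are tangent.\<close>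

lemma derivative_pairings:
  assumes p: "p \<in> D"
  shows "nmetric (pd_u l p) (pd_u z p) = - e p" "nmetric (pd_u l p) (pd_v z p) = - f p"
    "nmetric (pd_v l p) (pd_u z p) = - f p" "nmetric (pd_v l p) (pd_v z p) = - g p"
    "nmetric (pd_u l p) (b p) = 0" "nmetric (pd_v l p) (b p) = 0"
    "nmetric (pd_u l p) (l p) = 0" "nmetric (pd_v l p) (l p) = 0"
proof -
  note d = smooth_on_planeD(1)[OF smooth(2) p] smooth_on_planeD(1)[OF smooth(3) p]
  note dz = smooth_on_planeD(1)[OF smooth_on_planeD(2)[OF smooth(1)] p]
    smooth_on_planeD(1)[OF smooth_on_planeD(3)[OF smooth(1)] p]
  have 1: "nmetric (l q) (pd_u z q) = 0" "nmetric (l q) (pd_v z q) = 0" "nmetric (l q) (b q) = 0"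
    if "q \<in> D" for q
    using normal(2)[OF that] unit(3)[OF that] by (simp_all add: normal_at_def nmetric_commute)
  show "nmetric (pd_u l p) (pd_u z p) = - e p" "nmetric (pd_u l p) (pd_v z p) = - f p"
    "nmetric (pd_v l p) (pd_u z p) = - f p" "nmetric (pd_v l p) (pd_v z p) = - g p"
    using pd_nmetric_const[OF D p 1(1) d(2) dz(1)] pd_nmetric_const[OF D p 1(2) d(2) dz(2)]
      mixed_partials[OF D p smooth(1)]
    by (simp_all add: e_def f_def g_def c11_def c12_def c22_def nmetric_commute)
  show "nmetric (pd_u l p) (b p) = 0" "nmetric (pd_v l p) (b p) = 0"
    using pd_nmetric_const[OF D p 1(3) d(2,1)] parallel[OF p] by (simp_all add: nmetric_commute)
  note n = pd_bilinear[OF nmetric.bounded_bilinear_axioms d(2,2)]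
  note nn = pd_bilinear[OF bounded_bilinear_mult n(3,3)]
  have 2: "nmetric (l q) (l q) * nmetric (l q) (l q) = 1" if "q \<in> D" for q
    using unit(1,2)[OF that] by (auto simp: abs_if split: if_splits)
  have "nmetric (l p) (l p) \<noteq> 0" using 2[OF p] by auto
  then show "nmetric (pd_u l p) (l p) = 0" "nmetric (pd_v l p) (l p) = 0"
    using differentiable_plane_cong(2,3)[OF D p 2 nn(3)] nn(1,2) n(1,2)
    by (simp_all add: pd_const nmetric_commute)
qed

text \<open>In the basis \<open>x, y\<close> the Weingarten formula exchanges the two null forms: \<open>dl = m (x q - y p)\<close>.
  Both sides have the same products with the tangent vectors and with \<open>b\<close> and \<open>l\<close>.\<close>

lemma normal_derivative:
  assumes p: "p \<in> D"
  shows "pd_u l p = (m p * kap p) *\<^sub>R x p + (- (m p * rho p)) *\<^sub>R y p"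
    "pd_v l p = (m p * q2 p) *\<^sub>R x p + (- (m p * p2 p)) *\<^sub>R y p"
proof -
  note EW = EW[OF p] and rk = rho_kap[OF p] and np = null_pairings[OF p]
  interpret split_frame "pd_u z p" "pd_v z p" "b p" "l p"
    using gram_neg[OF adm[OF p]] normal[OF p] unit[OF p]
    by unfold_locales
      (auto simp: gram_def coeff_E_def coeff_F_def coeff_G_def normal_at_def)
  have o: "nmetric (x p) (b p) = 0" "nmetric (x p) (l p) = 0" "nmetric (y p) (b p) = 0" "nmetric (y p) (l p) = 0"
    using orth' by (simp_all add: x_def y_def nmetric_linear)
  have m: "m p * kap p * (1 / rho p) = (kap p)\<^sup>2 / E p" "m p * rho p * (1 / kap p) = (rho p)\<^sup>2 / E p"
    using rk EW by (simp_all add: m_def power2_eq_square)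
  have A: "(kap p)\<^sup>2 * (F p - W p) - (rho p)\<^sup>2 * (F p + W p) = - 2 * E p * f p"
    using rk(6,7) by algebra
  have B: "(kap p)\<^sup>2 * (F p - W p)\<^sup>2 - (rho p)\<^sup>2 * (F p + W p)\<^sup>2 = - 2 * (E p)\<^sup>2 * g p"
    using rk(6,7) EW(3) traceless[OF p] unfolding e_def[symmetric] f_def[symmetric] g_def[symmetric]
    by algebra
  have "m p * kap p * (E p / (2 * rho p)) - m p * rho p * (E p / (2 * kap p))
      = ((kap p)\<^sup>2 - (rho p)\<^sup>2) / 2"
    "m p * kap p * ((F p - W p) / (2 * rho p)) - m p * rho p * ((F p + W p) / (2 * kap p))
      = ((kap p)\<^sup>2 * (F p - W p) - (rho p)\<^sup>2 * (F p + W p)) / (2 * E p)"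
    "m p * q2 p * (E p / (2 * rho p)) - m p * p2 p * (E p / (2 * kap p))
      = ((kap p)\<^sup>2 * (F p - W p) - (rho p)\<^sup>2 * (F p + W p)) / (2 * E p)"
    "m p * q2 p * ((F p - W p) / (2 * rho p)) - m p * p2 p * ((F p + W p) / (2 * kap p))
      = ((kap p)\<^sup>2 * (F p - W p)\<^sup>2 - (rho p)\<^sup>2 * (F p + W p)\<^sup>2) / (2 * (E p)\<^sup>2)"
    using rk EW(1) by (simp_all add: m_def p2_def q2_def field_simps power2_eq_square)
  then have t: "m p * kap p * (E p / (2 * rho p)) - m p * rho p * (E p / (2 * kap p)) = - e p"
    "m p * kap p * ((F p - W p) / (2 * rho p)) - m p * rho p * ((F p + W p) / (2 * kap p)) = - f p"
    "m p * q2 p * (E p / (2 * rho p)) - m p * p2 p * (E p / (2 * kap p)) = - f p"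
    "m p * q2 p * ((F p - W p) / (2 * rho p)) - m p * p2 p * ((F p + W p) / (2 * kap p)) = - g p"
    using EW(1) unfolding A B rk(6) by simp_all
  show "pd_u l p = (m p * kap p) *\<^sub>R x p + (- (m p * rho p)) *\<^sub>R y p"
    by (rule eqI) (use t in \<open>simp_all add: nmetric_linear np o derivative_pairings[OF p]\<close>)
  show "pd_v l p = (m p * q2 p) *\<^sub>R x p + (- (m p * p2 p)) *\<^sub>R y p"
    by (rule eqI) (use t in \<open>simp_all add: nmetric_linear np o derivative_pairings[OF p]\<close>)
qed

lemma coframe_closed:
  assumes p: "p \<in> D"
  shows "pd_v rho p = pd_u p2 p" "pd_v kap p = pd_u q2 p"
  by (rule null_coframe_closed[OF D p smooth(1,3) smooth_coframe(6,7,1,4,2,5,3)];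
      fact null_pairings null_decomposition normal_derivative)+

end

context traceless_normal
begin

text \<open>The orthogonal coframe \<open>(p + q) / 2\<close>, \<open>(p - q) / 2\<close>, with components \<open>a1, a2\<close> and \<open>b1, b2\<close>.  Its
  members are the differentials of the canonical parameters.\<close>

definition a1 where "a1 p = (1/2) *\<^sub>R rho p + (1/2) *\<^sub>R kap p"
definition a2 where "a2 p = (1/2) *\<^sub>R p2 p + (1/2) *\<^sub>R q2 p"
definition b1 where "b1 p = (1/2) *\<^sub>R rho p + (-1/2) *\<^sub>R kap p"
definition b2 where "b2 p = (1/2) *\<^sub>R p2 p + (-1/2) *\<^sub>R q2 p"

lemma smooth_ab:
  "smooth_on_plane a1 D" "smooth_on_plane a2 D" "smooth_on_plane b1 D" "smooth_on_plane b2 D"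
  unfolding a1_def[abs_def] a2_def[abs_def] b1_def[abs_def] b2_def[abs_def]
  by (rule smooth_add smooth_scaleR smooth_const D smooth_coframe)+

lemma ab_closed:
  assumes p: "p \<in> D"
  shows "pd_v a1 p = pd_u a2 p" "pd_v b1 p = pd_u b2 p"
proof -
  note d = smooth_coframe(1,2,4,5)[THEN smooth_on_planeD(1), OF p]
  have c: "(\<lambda>_. r) differentiable (at p)" for r :: real by simp
  show "pd_v a1 p = pd_u a2 p"
    unfolding a1_def[abs_def] a2_def[abs_def] pd_lincomb(2)[OF c c d(1,2)] pd_lincomb(1)[OF c c d(3,4)]
    by (simp add: pd_const coframe_closed[OF p])
  show "pd_v b1 p = pd_u b2 p"
    unfolding b1_def[abs_def] b2_def[abs_def] pd_lincomb(2)[OF c c d(1,2)] pd_lincomb(1)[OF c c d(3,4)]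
    by (simp add: pd_const coframe_closed[OF p])
qed

lemma ab_det:
  assumes p: "p \<in> D"
  shows "a1 p * b2 p - b1 p * a2 p \<noteq> 0"
proof -
  have "a1 p * b2 p - b1 p * a2 p = (kap p * p2 p - rho p * q2 p) / 2"
    by (simp add: a1_def a2_def b1_def b2_def field_simps)
  also have "\<dots> = rho p * kap p * W p / E p"
    using EW[OF p] by (simp add: p2_def q2_def field_simps)
  finally show ?thesis using EW[OF p] rho_kap[OF p] by simp
qed

lemma orthogonal_decomposition:
  assumes p: "p \<in> D"
  shows "pd_u z p = a1 p *\<^sub>R (x p + y p) + b1 p *\<^sub>R (x p - y p)"
    "pd_v z p = a2 p *\<^sub>R (x p + y p) + b2 p *\<^sub>R (x p - y p)"
    "pd_u l p = m p *\<^sub>R (a1 p *\<^sub>R (x p - y p) - b1 p *\<^sub>R (x p + y p))"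
    "pd_v l p = m p *\<^sub>R (a2 p *\<^sub>R (x p - y p) - b2 p *\<^sub>R (x p + y p))"
  unfolding null_decomposition[OF p] normal_derivative[OF p] a1_def a2_def b1_def b2_def
  by (simp_all add: vec_eq_iff field_simps)

lemma orthogonal_pairings:
  assumes p: "p \<in> D"
  shows "nmetric (x p + y p) (x p + y p) = 1 / m p" "nmetric (x p - y p) (x p - y p) = - 1 / m p"
    "nmetric (x p + y p) (x p - y p) = 0"
proof -
  have "nmetric (x p) (y p) = 1 / (2 * m p)" using null_pairings(3)[OF p] rho_kap(5)[OF p]
    by (simp add: field_simps)
  then show "nmetric (x p + y p) (x p + y p) = 1 / m p" "nmetric (x p - y p) (x p - y p) = - 1 / m p"
    "nmetric (x p + y p) (x p - y p) = 0"
    using null_pairings(1,2)[OF p] rho_kap(5)[OF p]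
    by (simp_all add: nmetric_linear nmetric_commute[of "y p" "x p"])
qed

text \<open>The potentials of the two closed forms are the new parameters, and the map \<open>\<phi>\<close> from the new
  parameters to the old ones inverts them.\<close>

lemma adapted_parameters:
  assumes "p0 \<in> D"
  obtains U V \<phi> where "p0 \<in> U" "U \<subseteq> D" "plane_domain U" "plane_domain V" "plane_diffeo \<phi> V U"
    "\<And>q. q \<in> V \<Longrightarrow> \<phi> q \<in> D"
    "\<And>q. q \<in> V \<Longrightarrow> fst (pd_u \<phi> q) * a1 (\<phi> q) + snd (pd_u \<phi> q) * a2 (\<phi> q) = 1"
    "\<And>q. q \<in> V \<Longrightarrow> fst (pd_u \<phi> q) * b1 (\<phi> q) + snd (pd_u \<phi> q) * b2 (\<phi> q) = 0"
    "\<And>q. q \<in> V \<Longrightarrow> fst (pd_v \<phi> q) * a1 (\<phi> q) + snd (pd_v \<phi> q) * a2 (\<phi> q) = 0"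
    "\<And>q. q \<in> V \<Longrightarrow> fst (pd_v \<phi> q) * b1 (\<phi> q) + snd (pd_v \<phi> q) * b2 (\<phi> q) = 1"
proof -
  obtain r u where u: "r > 0" "ball p0 r \<subseteq> D"
    "\<And>p. p \<in> ball p0 r \<Longrightarrow> (u has_derivative (\<lambda>h. fst h *\<^sub>R a1 p + snd h *\<^sub>R a2 p)) (at p)"
  proof (rule closed_form_has_potential[OF D assms smooth_ab(1,2) ab_closed(1)])
    fix r u
    assume "r > 0" "ball p0 r \<subseteq> D"
      "\<And>p. p \<in> ball p0 r \<Longrightarrow> (u has_derivative (\<lambda>h. fst h *\<^sub>R a1 p + snd h *\<^sub>R a2 p)) (at p)"
    then show thesis by (rule that)
  qed
  obtain s v where v: "s > 0" "ball p0 s \<subseteq> D"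
    "\<And>p. p \<in> ball p0 s \<Longrightarrow> (v has_derivative (\<lambda>h. fst h *\<^sub>R b1 p + snd h *\<^sub>R b2 p)) (at p)"
  proof (rule closed_form_has_potential[OF D assms smooth_ab(3,4) ab_closed(2)])
    fix s v
    assume "s > 0" "ball p0 s \<subseteq> D"
      "\<And>p. p \<in> ball p0 s \<Longrightarrow> (v has_derivative (\<lambda>h. fst h *\<^sub>R b1 p + snd h *\<^sub>R b2 p)) (at p)"
    then show thesis by (rule that)
  qed
  define D' where "D' = ball p0 (min r s)"
  have D': "open D'" "p0 \<in> D'" "D' \<subseteq> D" using u v by (auto simp: D'_def)
  have sub: "p \<in> ball p0 r" "p \<in> ball p0 s" "p \<in> D" if "p \<in> D'" for p
    using that D'(3) by (auto simp: D'_def)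
  have d: "((\<lambda>p. (u p, v p)) has_derivative (\<lambda>h. fst h *\<^sub>R (a1 p, b1 p) + snd h *\<^sub>R (a2 p, b2 p))) (at p)"
    if "p \<in> D'" for p
    using has_derivative_Pair[OF u(3)[OF sub(1)[OF that]] v(3)[OF sub(2)[OF that]]] by simp
  have S: "smooth_on_plane (\<lambda>p. (a1 p, b1 p)) D'" "smooth_on_plane (\<lambda>p. (a2 p, b2 p)) D'"
    by (rule smooth_on_plane_subset[OF smooth_Pair[OF D] D'(3)], rule smooth_ab, rule smooth_ab)+
  have "fst (a1 p, b1 p) * snd (a2 p, b2 p) - snd (a1 p, b1 p) * fst (a2 p, b2 p) \<noteq> 0"
    if "p \<in> D'" for p
    using ab_det[OF sub(3)[OF that]] by simp
  note diffeo = local_diffeo[OF D'(1,2) d S this]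
  show thesis
  proof (rule diffeo)
    fix U V \<phi>
    assume *: "p0 \<in> U" "U \<subseteq> D'" "plane_domain U" "plane_domain V" "plane_diffeo \<phi> V U"
      and im: "\<And>q. q \<in> V \<Longrightarrow> \<phi> q \<in> U"
      and 1: "\<And>q. q \<in> V \<Longrightarrow> fst (pd_u \<phi> q) *\<^sub>R (a1 (\<phi> q), b1 (\<phi> q)) + snd (pd_u \<phi> q) *\<^sub>R (a2 (\<phi> q), b2 (\<phi> q)) = (1, 0)"
        "\<And>q. q \<in> V \<Longrightarrow> fst (pd_v \<phi> q) *\<^sub>R (a1 (\<phi> q), b1 (\<phi> q)) + snd (pd_v \<phi> q) *\<^sub>R (a2 (\<phi> q), b2 (\<phi> q)) = (0, 1)"
    have UD: "U \<subseteq> D" using *(2) D'(3) by (rule subset_trans)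
    show thesis
      by (rule that[OF *(1) UD *(3-5) subsetD[OF UD im]]) (use 1 in \<open>simp_all add: prod_eq_iff\<close>)
  qed
qed

text \<open>In the new parameters the coordinate vectors are \<open>x + y\<close> and \<open>x - y\<close>, and \<open>l\<close> has the derivatives
  \<open>m (x - y)\<close> and \<open>- m (x + y)\<close>.  Differentiating the orthogonality relations between \<open>l\<close> and the
  coordinate vectors then yields the coefficients of the second fundamental form that the pointwise criterion asks
  for.\<close>

lemma canonical_composition:
  assumes V: "open V" and \<phi>: "smooth_on_plane \<phi> V" "\<And>q. q \<in> V \<Longrightarrow> \<phi> q \<in> D"
    and dual: "\<And>q. q \<in> V \<Longrightarrow> fst (pd_u \<phi> q) * a1 (\<phi> q) + snd (pd_u \<phi> q) * a2 (\<phi> q) = 1"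
      "\<And>q. q \<in> V \<Longrightarrow> fst (pd_u \<phi> q) * b1 (\<phi> q) + snd (pd_u \<phi> q) * b2 (\<phi> q) = 0"
      "\<And>q. q \<in> V \<Longrightarrow> fst (pd_v \<phi> q) * a1 (\<phi> q) + snd (pd_v \<phi> q) * a2 (\<phi> q) = 0"
      "\<And>q. q \<in> V \<Longrightarrow> fst (pd_v \<phi> q) * b1 (\<phi> q) + snd (pd_v \<phi> q) * b2 (\<phi> q) = 1"
  shows "canonical_parameters V (\<lambda>q. z (\<phi> q))"
proof -
  let ?w = "\<lambda>q. z (\<phi> q)" and ?l = "\<lambda>q. l (\<phi> q)" and ?b = "\<lambda>q. b (\<phi> q)"
  have im: "\<phi> ` V \<subseteq> D" using \<phi>(2) by blast
  have w: "smooth_on_plane ?w V" by (rule smooth_comp[OF V im smooth(1) \<phi>(1)])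
  have sl: "smooth_on_plane ?l V" by (rule smooth_comp[OF V im smooth(3) \<phi>(1)])
  have sb: "smooth_on_plane ?b V" by (rule smooth_comp[OF V im smooth(2) \<phi>(1)])
  note chain = pd_comp(1,2)[OF smooth_on_planeD(1)[OF _ \<phi>(2)] smooth_on_planeD(1)[OF \<phi>(1)]]
  have collect: "c1 *\<^sub>R (r1 *\<^sub>R v + s1 *\<^sub>R v') + c2 *\<^sub>R (r2 *\<^sub>R v + s2 *\<^sub>R v')
      = (c1 * r1 + c2 * r2) *\<^sub>R v + (c1 * s1 + c2 * s2) *\<^sub>R v'"
    "c1 *\<^sub>R t *\<^sub>R (r1 *\<^sub>R v - s1 *\<^sub>R v') + c2 *\<^sub>R t *\<^sub>R (r2 *\<^sub>R v - s2 *\<^sub>R v')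
      = t *\<^sub>R ((c1 * r1 + c2 * r2) *\<^sub>R v - (c1 * s1 + c2 * s2) *\<^sub>R v')"
    for c1 c2 r1 r2 s1 s2 t :: real and v v' :: "real^4"
    by (simp_all add: vec_eq_iff algebra_simps)
  have wuv: "pd_u ?w q = x (\<phi> q) + y (\<phi> q)" "pd_v ?w q = x (\<phi> q) - y (\<phi> q)"
    "pd_u ?l q = m (\<phi> q) *\<^sub>R (x (\<phi> q) - y (\<phi> q))" "pd_v ?l q = - m (\<phi> q) *\<^sub>R (x (\<phi> q) + y (\<phi> q))"
    if q: "q \<in> V" for q
    unfolding chain[OF smooth(1) q q] chain[OF smooth(3) q q] orthogonal_decomposition[OF \<phi>(2)[OF q]]
      collect dual[OF q] by (simp_all add: scaleR_diff_right scaleR_add_right)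
  have "principal_at ?w q \<and> \<bar>mu ?w q\<bar> = m (\<phi> q) \<and> coeff_E ?w q = 1 / m (\<phi> q)
      \<and> coeff_F ?w q = 0 \<and> coeff_G ?w q = - 1 / m (\<phi> q)" if q: "q \<in> V" for q
  proof -
    let ?p = "\<phi> q"
    note pD = \<phi>(2)[OF q] and wq = wuv[OF q] and op = orthogonal_pairings[OF \<phi>(2)[OF q]]
    have m0: "m ?p > 0" by (rule rho_kap(5)[OF pD])
    have EFG: "coeff_E ?w q = 1 / m ?p" "coeff_F ?w q = 0" "coeff_G ?w q = - 1 / m ?p"
      unfolding coeff_E_def coeff_F_def coeff_G_def wq op by simp_all
    have norm: "normal_at ?w q' n" if "q' \<in> V" "normal_at z (\<phi> q') n" for q' n
      using that(2) unfolding normal_at_def chain[OF smooth(1) that(1) that(1)]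
      by (simp add: nmetric_linear)
    note dw = smooth_on_planeD(1)[OF smooth_on_planeD(2)[OF w] q]
      smooth_on_planeD(1)[OF smooth_on_planeD(3)[OF w] q]
    have lb0: "nmetric (pd_u ?w q') (?l q') = 0" "nmetric (pd_v ?w q') (?l q') = 0"
      "nmetric (pd_u ?w q') (?b q') = 0" "nmetric (pd_v ?w q') (?b q') = 0" if "q' \<in> V" for q'
      using norm[OF that normal(1)[OF \<phi>(2)[OF that]]] norm[OF that normal(2)[OF \<phi>(2)[OF that]]]
      by (simp_all add: normal_at_def nmetric_commute)
    have cl: "c11 ?w q (?l q) = 0" "c12 ?w q (?l q) = 1" "c22 ?w q (?l q) = 0"
      using pd_nmetric_const[OF V q lb0(1) dw(1) smooth_on_planeD(1)[OF sl q]]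
        pd_nmetric_const[OF V q lb0(2) dw(2) smooth_on_planeD(1)[OF sl q]] m0
      by (simp_all add: c11_def c12_def c22_def wq nmetric.scaleR_right nmetric.minus_right op
          nmetric_commute[of "x ?p - y ?p" "x ?p + y ?p"])
    \<comment> \<open>The trace in the direction of \<open>b\<close> does not depend on the parameters, hence remains nonzero.\<close>
    have cb: "c11 ?w q (?b q) \<noteq> c22 ?w q (?b q)"
    proof
      assume eq: "c11 ?w q (?b q) = c22 ?w q (?b q)"
      define f1 f2 g1 g2 where "f1 = fst (pd_u \<phi> q)" and "f2 = snd (pd_u \<phi> q)"
        and "g1 = fst (pd_v \<phi> q)" and "g2 = snd (pd_v \<phi> q)"
      note fg = f1_def[symmetric] f2_def[symmetric] g1_def[symmetric] g2_def[symmetric]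
      have wc: "pd_u ?w q = f1 *\<^sub>R pd_u z ?p + f2 *\<^sub>R pd_v z ?p"
        "pd_v ?w q = g1 *\<^sub>R pd_u z ?p + g2 *\<^sub>R pd_v z ?p"
        "pd_u ?b q = f1 *\<^sub>R pd_u b ?p + f2 *\<^sub>R pd_v b ?p"
        "pd_v ?b q = g1 *\<^sub>R pd_u b ?p + g2 *\<^sub>R pd_v b ?p"
        using chain[OF smooth(1) q q] chain[OF smooth(2) q q] by (simp_all add: fg)
      have bz: "nmetric (pd_u z p) (b p) = 0" "nmetric (pd_v z p) (b p) = 0" if "p \<in> D" for p
        using normal(1)[OF that] by (simp_all add: normal_at_def nmetric_commute)
      have A: "nmetric (pd_u z ?p) (pd_u b ?p) = - c11 z ?p (b ?p)"
        "nmetric (pd_u z ?p) (pd_v b ?p) = - c12 z ?p (b ?p)"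
        "nmetric (pd_v z ?p) (pd_u b ?p) = - c12 z ?p (b ?p)"
        "nmetric (pd_v z ?p) (pd_v b ?p) = - c22 z ?p (b ?p)"
        using pd_nmetric_const[OF D pD bz(1) smooth_on_planeD(1)[OF smooth_on_planeD(2)[OF smooth(1)] pD]
            smooth_on_planeD(1)[OF smooth(2) pD]]
          pd_nmetric_const[OF D pD bz(2) smooth_on_planeD(1)[OF smooth_on_planeD(3)[OF smooth(1)] pD]
            smooth_on_planeD(1)[OF smooth(2) pD]] mixed_partials[OF D pD smooth(1)]
        by (simp_all add: c11_def c12_def c22_def)
      have cw: "c11 ?w q (?b q) = f1\<^sup>2 * c11 z ?p (b ?p) + 2 * f1 * f2 * c12 z ?p (b ?p) + f2\<^sup>2 * c22 z ?p (b ?p)"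
        "c22 ?w q (?b q) = g1\<^sup>2 * c11 z ?p (b ?p) + 2 * g1 * g2 * c12 z ?p (b ?p) + g2\<^sup>2 * c22 z ?p (b ?p)"
        using pd_nmetric_const[OF V q lb0(3) dw(1) smooth_on_planeD(1)[OF sb q]]
          pd_nmetric_const[OF V q lb0(4) dw(2) smooth_on_planeD(1)[OF sb q]]
        by (simp_all add: c11_def[of ?w] c22_def[of ?w] wc nmetric_linear A power2_eq_square algebra_simps)
      have I: "E ?p * f1\<^sup>2 + 2 * F ?p * f1 * f2 + G ?p * f2\<^sup>2 = 1 / m ?p"
        "E ?p * g1\<^sup>2 + 2 * F ?p * g1 * g2 + G ?p * g2\<^sup>2 = - (1 / m ?p)"
        "E ?p * f1 * g1 + F ?p * (f1 * g2 + f2 * g1) + G ?p * f2 * g2 = 0"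
        using EFG unfolding coeff_E_def[of ?w] coeff_F_def[of ?w] coeff_G_def[of ?w] wc
        by (simp_all add: nmetric_linear coeff_E_def coeff_F_def coeff_G_def
            nmetric_commute[of "pd_v z ?p" "pd_u z ?p"] power2_eq_square algebra_simps)
      have t0: "1 / m ?p \<noteq> 0" using m0 by simp
      note tr = pseudo_orthogonal_trace[OF I t0]
      have "1 / m ?p * (G ?p * c11 z ?p (b ?p) - 2 * F ?p * c12 z ?p (b ?p) + E ?p * c22 z ?p (b ?p))
        = (c11 ?w q (?b q) - c22 ?w q (?b q)) * (E ?p * G ?p - (F ?p)\<^sup>2)"
        unfolding cw using tr by algebra
      then show False using eq trace[OF pD] m0 by simp
    qed
    note can = canonical_at[OF V q w m0 EFG norm[OF q normal(1)[OF pD]] unit(1)[OF pD]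
        norm[OF q normal(2)[OF pD]] unit(2,3)[OF pD] cl cb]
    show ?thesis using can EFG by simp
  qed
  then show ?thesis unfolding canonical_parameters_def by simp
qed

theorem locally_canonical:
  assumes "p0 \<in> D"
  shows "\<exists>U V \<phi>. p0 \<in> U \<and> U \<subseteq> D \<and> plane_domain U \<and> plane_domain V \<and>
    plane_diffeo \<phi> V U \<and> canonical_parameters V (z \<circ> \<phi>)"
proof -
  show ?thesis
  proof (rule adapted_parameters[OF assms])
    fix U V \<phi>
    assume *: "p0 \<in> U" "U \<subseteq> D" "plane_domain U" "plane_domain V" "plane_diffeo \<phi> V U"
      and \<phi>: "\<And>q. q \<in> V \<Longrightarrow> \<phi> q \<in> D"
      "\<And>q. q \<in> V \<Longrightarrow> fst (pd_u \<phi> q) * a1 (\<phi> q) + snd (pd_u \<phi> q) * a2 (\<phi> q) = 1"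
      "\<And>q. q \<in> V \<Longrightarrow> fst (pd_u \<phi> q) * b1 (\<phi> q) + snd (pd_u \<phi> q) * b2 (\<phi> q) = 0"
      "\<And>q. q \<in> V \<Longrightarrow> fst (pd_v \<phi> q) * a1 (\<phi> q) + snd (pd_v \<phi> q) * a2 (\<phi> q) = 0"
      "\<And>q. q \<in> V \<Longrightarrow> fst (pd_v \<phi> q) * b1 (\<phi> q) + snd (pd_v \<phi> q) * b2 (\<phi> q) = 1"
    have "open V" "smooth_on_plane \<phi> V"
      using *(4,5) by (simp_all add: plane_domain_def plane_diffeo_def)
    from canonical_composition[OF this \<phi>] have "canonical_parameters V (z \<circ> \<phi>)"
      by (simp add: comp_def)
    with * show ?thesis by (intro exI[of _ U] exI[of _ V] exI[of _ \<phi>] conjI)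
  qed
qed

end

section \<open>Surfaces of general type\<close>

text \<open>The left-hand side is \<open>W\<^sup>6 (\<kappa>\<^sup>2 - k)\<close>, where \<open>A1, A2, A3\<close> and \<open>e, f, g\<close> are the coefficients of the
  second fundamental form in two normal directions.  In an orthonormal tangent basis tracelessness means
  \<open>e = g\<close>, both sides reduce to \<open>(f\<^sup>2 - e\<^sup>2) (A1 - A3)\<^sup>2\<close>, and they transform alike under changes of the
  basis.\<close>

lemma discriminant_factors:
  fixes E F G A1 A2 A3 e f g :: real
  assumes "G * e - 2 * F * f + E * g = 0"
  shows "(E * (A2 * g - A3 * f) + G * (A1 * f - A2 * e) - F * (A1 * g - A3 * e))\<^sup>2
    - (E * G - F\<^sup>2) * (4 * (A1 * f - A2 * e) * (A2 * g - A3 * f) - (A1 * g - A3 * e)\<^sup>2)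
    = (f\<^sup>2 - e * g) * (G * A1 - 2 * F * A2 + E * A3)\<^sup>2"
  using assms by algebra

text \<open>The invariants \<open>\<kappa>\<^sup>2\<close> and \<open>k\<close> are even in the minors \<open>\<Delta>\<^sub>1, \<Delta>\<^sub>2, \<Delta>\<^sub>3\<close>, which change sign when the two
  normals are interchanged.  Therefore it does not matter which of \<open>b\<close> and \<open>l\<close> is the spacelike
  one.\<close>

lemma inv_discriminant:
  assumes adm: "admissible_at z p"
    and tl: "coeff_G z p * c11 z p l - 2 * coeff_F z p * c12 z p l + coeff_E z p * c22 z p l = 0"
    and nn: "(n1 = b \<and> n2 = l) \<or> (n1 = l \<and> n2 = b)"
    and pos: "(inv_kappa z p n1 n2)\<^sup>2 - inv_k z p n1 n2 > 0"
  shows "(c12 z p l)\<^sup>2 - c11 z p l * c22 z p l > 0"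
proof -
  let ?E = "coeff_E z p" and ?F = "coeff_F z p" and ?G = "coeff_G z p" and ?W = "coeff_W z p"
  have Q: "?E * ?G - ?F\<^sup>2 < 0" using gram_neg[OF adm] by (simp add: gram_def)
  then have W: "?W > 0" "?W * ?W = - (?E * ?G - ?F\<^sup>2)" by (simp_all add: coeff_W_def)
  have Q': "?E * ?G - ?F\<^sup>2 = - (?W * ?W)" using W(2) by simp
  define K where "K = (?E * Delta3 z p n1 n2 + ?G * Delta1 z p n1 n2 - ?F * Delta2 z p n1 n2)\<^sup>2
    - (?E * ?G - ?F\<^sup>2) * (4 * Delta1 z p n1 n2 * Delta3 z p n1 n2 - (Delta2 z p n1 n2)\<^sup>2)"
  have "inv_kappa z p n1 n2 = - (?E * Delta3 z p n1 n2 + ?G * Delta1 z p n1 n2 - ?F * Delta2 z p n1 n2) / ?W ^ 3"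
    unfolding inv_kappa_def coeff_L_def coeff_M_def coeff_N_def Q'
    using W(1) by (simp add: power3_eq_cube field_simps)
  moreover have "inv_k z p n1 n2 = - (4 * Delta1 z p n1 n2 * Delta3 z p n1 n2 - (Delta2 z p n1 n2)\<^sup>2) / ?W ^ 4"
    unfolding inv_k_def coeff_L_def coeff_M_def coeff_N_def Q'
    using W(1) by (simp add: power4_eq_xxxx power2_eq_square field_simps)
  moreover have "K = (?E * Delta3 z p n1 n2 + ?G * Delta1 z p n1 n2 - ?F * Delta2 z p n1 n2)\<^sup>2
    + ?W * ?W * (4 * Delta1 z p n1 n2 * Delta3 z p n1 n2 - (Delta2 z p n1 n2)\<^sup>2)"
    unfolding K_def Q' by simp
  moreover have "(- a / ?W ^ 3)\<^sup>2 - (- r / ?W ^ 4) = (a\<^sup>2 + ?W * ?W * r) / ?W ^ 6" for a r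
    using W(1) by (simp add: field_simps eval_nat_numeral)
  ultimately have "(inv_kappa z p n1 n2)\<^sup>2 - inv_k z p n1 n2 = K / ?W ^ 6"
    by (simp only: minus_divide_left)
  then have "K > 0" using pos W by (simp add: zero_less_divide_iff)
  moreover have "K = ((c12 z p l)\<^sup>2 - c11 z p l * c22 z p l)
    * (?G * c11 z p b - 2 * ?F * c12 z p b + ?E * c22 z p b)\<^sup>2"
    unfolding discriminant_factors[OF tl, symmetric]
    using nn by (auto simp: K_def Delta1_def Delta2_def Delta3_def power2_eq_square algebra_simps)
  ultimately show ?thesis
    by (metis mult_pos_pos not_less zero_le_power2 zero_less_mult_iff less_eq_real_def)
qed

lemma smooth_ncross:
  assumes U: "open U" and s: "smooth_on_plane x U" "smooth_on_plane y U" "smooth_on_plane n U"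
  shows "smooth_on_plane (\<lambda>p. ncross (x p) (y p) (n p)) U"
proof -
  have nth: "smooth_on_plane (\<lambda>p. x p $ i) U" "smooth_on_plane (\<lambda>p. y p $ i) U"
    "smooth_on_plane (\<lambda>p. n p $ i) U" for i
    by (rule smooth_bounded_linear[OF U bounded_linear_vec_nth] s)+
  show ?thesis
    unfolding ncross_def minor3_def
    by (rule smooth_add smooth_diff smooth_minus smooth_mult smooth_scaleR smooth_const U nth)+
qed


theorem theorem6p3:
  fixes D :: "(real \<times> real) set" and z :: "real \<times> real \<Rightarrow> real^4"
  assumes "lorentz_surface D z"
    and "general_type D z"
    and "parallel_normalized_mean_curvature D z"
  shows "\<forall>p\<in>D. \<exists>U V \<phi>. p \<in> U \<and> U \<subseteq> D \<and> plane_domain U \<and> plane_domain V \<and>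
           plane_diffeo \<phi> V U \<and> canonical_parameters V (z \<circ> \<phi>)"
proof
  fix p0 assume p0: "p0 \<in> D"
  have D: "open D" and z: "smooth_on_plane z D" and adm: "\<And>p. p \<in> D \<Longrightarrow> admissible_at z p"
    using assms(1) by (simp_all add: lorentz_surface_def plane_domain_def)
  have H0: "\<And>p. p \<in> D \<Longrightarrow> mean_curvature z p \<noteq> 0"
    using assms(3) by (simp add: parallel_normalized_mean_curvature_def)
  obtain b where b: "smooth_on_plane b D" "\<And>p. p \<in> D \<Longrightarrow> normal_at z p (b p)"
    "\<And>p. p \<in> D \<Longrightarrow> \<bar>nmetric (b p) (b p)\<bar> = 1" "\<And>p. p \<in> D \<Longrightarrow> \<exists>c. mean_curvature z p = c *\<^sub>R b p"
    "\<And>p \<xi>. p \<in> D \<Longrightarrow> normal_connection z b p \<xi> = 0"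
    using assms(3) unfolding parallel_normalized_mean_curvature_def by blast
  \<comment> \<open>The vector product has square \<open>(E G - F\<^sup>2) \<langle>b, b\<rangle>\<close>, so division by \<open>W\<close> makes it a unit vector of the
    causal character opposite to that of \<open>b\<close>.\<close>
  define l0 where "l0 p = (1 / coeff_W z p) *\<^sub>R ncross (pd_u z p) (pd_v z p) (b p)" for p
  have W: "coeff_W z p > 0" "coeff_W z p * coeff_W z p = - gram z p" if "p \<in> D" for p
    using gram_neg[OF adm[OF that]] by (simp_all add: coeff_W_def gram_def)
  have nc: "smooth_on_plane (\<lambda>p. ncross (pd_u z p) (pd_v z p) (b p)) D"
    by (rule smooth_ncross[OF D smooth_on_planeD(2)[OF z] smooth_on_planeD(3)[OF z] b(1)])
  have sW: "smooth_on_plane (coeff_W z) D" by (rule smooth_coeff_W[OF D z adm])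
  have W0: "coeff_W z p \<noteq> 0" if "p \<in> D" for p using W(1)[OF that] by simp
  have sl0: "smooth_on_plane l0 D"
    unfolding l0_def[abs_def]
    by (rule smooth_scaleR[OF D smooth_divide[OF D W0 smooth_const[OF D] sW] nc])
  have normal: "normal_at z p (l0 p)" and bl: "nmetric (b p) (l0 p) = 0"
    and ll: "nmetric (l0 p) (l0 p) = - nmetric (b p) (b p)" if p: "p \<in> D" for p
  proof -
    show "normal_at z p (l0 p)" by (simp add: normal_at_def l0_def nmetric_linear ncross_orth)
    show "nmetric (b p) (l0 p) = 0"
      by (simp add: l0_def nmetric_linear ncross_orth nmetric_commute[of "b p"])
    have "nmetric (pd_u z p) (b p) = 0" "nmetric (pd_v z p) (b p) = 0"
      using b(2)[OF p] by (simp_all add: normal_at_def nmetric_commute)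
    from ncross_norm[OF this] have "nmetric (l0 p) (l0 p)
        = (1 / (coeff_W z p * coeff_W z p)) * (gram z p * nmetric (b p) (b p))"
      by (simp add: l0_def nmetric_linear gram_def coeff_E_def coeff_F_def coeff_G_def)
    then show "nmetric (l0 p) (l0 p) = - nmetric (b p) (b p)"
      using gram_neg[OF adm[OF p]] by (simp add: W[OF p])
  qed
  \<comment> \<open>The derivative of \<open>b\<close> is tangent, by \<open>Db = 0\<close>.\<close>
  have par: "nmetric (pd_u b p) (l0 p) = 0" "nmetric (pd_v b p) (l0 p) = 0" if p: "p \<in> D" for p
    using b(5)[OF p, of "(1, 0)"] b(5)[OF p, of "(0, 1)"] nmetric_normal_part[OF adm[OF p] normal[OF p]]
    unfolding normal_connection_def pd_u_def pd_v_def by (metis nmetric.zero_left)+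
  have tl: "coeff_G z p * c11 z p (l0 p) - 2 * coeff_F z p * c12 z p (l0 p) + coeff_E z p * c22 z p (l0 p) = 0"
    and tb: "coeff_G z p * c11 z p (b p) - 2 * coeff_F z p * c12 z p (b p) + coeff_E z p * c22 z p (b p) \<noteq> 0"
    if p: "p \<in> D" for p
  proof -
    obtain c where c: "mean_curvature z p = c *\<^sub>R b p" using b(4)[OF p] by blast
    then have "c \<noteq> 0" using H0[OF p] by auto
    moreover have "nmetric (b p) (b p) \<noteq> 0" using b(3)[OF p] by auto
    moreover have "gram z p \<noteq> 0" using gram_neg[OF adm[OF p]] by simp
    ultimately show "coeff_G z p * c11 z p (l0 p) - 2 * coeff_F z p * c12 z p (l0 p) + coeff_E z p * c22 z p (l0 p) = 0"
      "coeff_G z p * c11 z p (b p) - 2 * coeff_F z p * c12 z p (b p) + coeff_E z p * c22 z p (b p) \<noteq> 0"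
      using nmetric_mean_curvature[OF D p z adm[OF p] normal[OF p]]
        nmetric_mean_curvature[OF D p z adm[OF p] b(2)[OF p]]
      by (auto simp: c nmetric_linear bl[OF p])
  qed
  define S where "S p = coeff_E z p * c12 z p (l0 p) - coeff_F z p * c11 z p (l0 p)" for p
  have S: "\<bar>coeff_W z p * c11 z p (l0 p)\<bar> < \<bar>S p\<bar>" if p: "p \<in> D" for p
  proof -
    define n1 n2 where "n1 = (if nmetric (b p) (b p) = 1 then b p else l0 p)"
      and "n2 = (if nmetric (b p) (b p) = 1 then l0 p else b p)"
    have "normal_frame z p n1 n2"
      using b(2,3)[OF p] normal[OF p] bl[OF p] ll[OF p]
      by (auto simp: normal_frame_def n1_def n2_def nmetric_commute abs_if split: if_splits)
    then have "(inv_kappa z p n1 n2)\<^sup>2 - inv_k z p n1 n2 > 0"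
      using assms(2) p unfolding general_type_def by blast
    then have pos: "(c12 z p (l0 p))\<^sup>2 - c11 z p (l0 p) * c22 z p (l0 p) > 0"
      using inv_discriminant[OF adm[OF p] tl[OF p], of n1 "b p" n2] by (auto simp: n1_def n2_def)
    have "(S p)\<^sup>2 - (coeff_W z p * c11 z p (l0 p))\<^sup>2
      = (coeff_E z p)\<^sup>2 * ((c12 z p (l0 p))\<^sup>2 - c11 z p (l0 p) * c22 z p (l0 p))"
      using tl[OF p] W(2)[OF p] unfolding S_def gram_def by algebra
    moreover have "coeff_E z p > 0" using adm[OF p] by (simp add: admissible_at_def)
    ultimately have "(coeff_W z p * c11 z p (l0 p))\<^sup>2 < (S p)\<^sup>2"
      using mult_pos_pos[OF zero_less_power[of "coeff_E z p" 2] pos] by linarith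
    then show ?thesis using abs_le_square_iff[of "S p" "coeff_W z p * c11 z p (l0 p)"] by linarith
  qed
  \<comment> \<open>With this sign of \<open>l\<close> the quantity \<open>E f - F e\<close> is positive at \<open>p0\<close>, hence nearby.\<close>
  define \<sigma> where "\<sigma> = sgn (S p0)"
  have \<sigma>: "\<sigma> * \<sigma> = 1" "\<bar>\<sigma>\<bar> = 1" "\<sigma> * S p0 > 0"
    using S[OF p0] by (auto simp: \<sigma>_def sgn_if)
  define l where "l p = \<sigma> *\<^sub>R l0 p" for p
  define D1 where "D1 = D \<inter> (\<lambda>p. \<sigma> * S p) -` {0<..}"
  show "\<exists>U V \<phi>. p0 \<in> U \<and> U \<subseteq> D \<and> plane_domain U \<and> plane_domain V \<and>
           plane_diffeo \<phi> V U \<and> canonical_parameters V (z \<circ> \<phi>)"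
  proof -
    have "smooth_on_plane (\<lambda>p. \<sigma> * S p) D"
      unfolding S_def
      by (rule smooth_mult smooth_diff smooth_const D smooth_first_form[OF D z]
          smooth_second_form[OF D z sl0])+
    then have "continuous_on D (\<lambda>p. \<sigma> * S p)" by (rule smooth_on_planeD(4))
    then have D1: "open D1" unfolding D1_def using D by (intro continuous_open_preimage) auto
    have D1D: "p \<in> D" "\<sigma> * S p > 0" if "p \<in> D1" for p using that by (auto simp: D1_def)
    have sub: "D1 \<subseteq> D" by (auto simp: D1_def)
    have cl: "c11 z p (l p) = \<sigma> * c11 z p (l0 p)" "c12 z p (l p) = \<sigma> * c12 z p (l0 p)"
      "c22 z p (l p) = \<sigma> * c22 z p (l0 p)" for p
      by (simp_all add: l_def c11_def c12_def c22_def nmetric_linear)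
    have sl: "smooth_on_plane l D"
      unfolding l_def[abs_def] by (rule smooth_scaleR smooth_const D sl0)+
    interpret traceless_normal D1 z b l
    proof
      fix p assume "p \<in> D1"
      note p = D1D(1)[OF this] and Sp = D1D(2)[OF this]
      show "admissible_at z p" by (rule adm[OF p])
      show "normal_at z p (b p)" by (rule b(2)[OF p])
      show "normal_at z p (l p)" using normal[OF p] by (simp add: normal_at_def l_def nmetric_linear)
      show "\<bar>nmetric (b p) (b p)\<bar> = 1" by (rule b(3)[OF p])
      show "nmetric (l p) (l p) = - nmetric (b p) (b p)"
        using ll[OF p] \<sigma>(1) by (simp add: l_def nmetric_linear flip: mult.assoc)
      show "nmetric (b p) (l p) = 0" "nmetric (pd_u b p) (l p) = 0" "nmetric (pd_v b p) (l p) = 0"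
        using bl[OF p] par[OF p] by (simp_all add: l_def nmetric_linear)
      have "coeff_G z p * c11 z p (l p) - 2 * coeff_F z p * c12 z p (l p) + coeff_E z p * c22 z p (l p)
        = \<sigma> * (coeff_G z p * c11 z p (l0 p) - 2 * coeff_F z p * c12 z p (l0 p) + coeff_E z p * c22 z p (l0 p))"
        by (simp add: cl algebra_simps)
      then show "coeff_G z p * c11 z p (l p) - 2 * coeff_F z p * c12 z p (l p) + coeff_E z p * c22 z p (l p) = 0"
        using tl[OF p] by simp
      show "coeff_G z p * c11 z p (b p) - 2 * coeff_F z p * c12 z p (b p) + coeff_E z p * c22 z p (b p) \<noteq> 0"
        by (rule tb[OF p])
      have "\<bar>coeff_W z p * c11 z p (l p)\<bar> = \<bar>coeff_W z p * c11 z p (l0 p)\<bar>"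
        by (simp add: cl abs_mult \<sigma>(2))
      also have "\<dots> < \<bar>\<sigma> * S p\<bar>" using S[OF p] by (simp add: abs_mult \<sigma>(2))
      also have "\<dots> = coeff_E z p * c12 z p (l p) - coeff_F z p * c11 z p (l p)"
        using Sp by (simp add: S_def cl algebra_simps)
      finally show "\<bar>coeff_W z p * c11 z p (l p)\<bar> < coeff_E z p * c12 z p (l p) - coeff_F z p * c11 z p (l p)" .
    qed (use D1 z b(1) sl sub in \<open>blast intro: smooth_on_plane_subset\<close>)+
    have "p0 \<in> D1" using p0 \<sigma>(3) by (simp add: D1_def)
    from locally_canonical[OF this] sub show ?thesis by (meson subset_trans)
  qed
qed

end
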